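(* Let $X, X_1,X_2,\dots$ be iid. For each $N$ and $i=1,\dots,C$ let $D_i^{(N)}\subseteq\{1,\dots,N\}$, $n_i^{(N)}=|D_i^{(N)}|$, $r_i(N)=n_i^{(N)}/N$, $\omega_{ij}(N)=|D_i^{(N)}\cap D_j^{(N)}|/N$, and let $T_i^{(N)}$ be a statistic computed on $(X_k)_{k\in D_i^{(N)}}$, estimating $\theta_i$ and asymptotically linear with influence function $\psi_i$, where $\mathbb E[\psi_i(X)^2]>0$. Assume $Nr_i(N)\to\infty$ and $\omega_{ij}(N)/\sqrt{r_i(N)r_j(N)}\to\varrho_{ij}$ for all $i,j$. Then the asymptotic Pearson correlation $\rho(T_i,T_j)$ satisfies $$\rho(T_i,T_j)\;\le\;\varrho_{ij}\,\frac{\mathbb E[\psi_i(X)\psi_j(X)]}{\sqrt{\mathbb E[\psi_i(X)^2]\,\mathbb E[\psi_j(X)^2]}}\;\le\;\varrho_{ij}.$$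
   Context: $T_i^{(N)}$ is asymptotically linear with influence function $\psi_i$ if $T_i^{(N)}-\theta_i=\frac{1}{n_i^{(N)}}\sum_{k\in D_i^{(N)}}\psi_i(X_k)+o_p\big((n_i^{(N)})^{-1/2}\big)$ with $\mathbb E[\psi_i(X)]=0$ and $\operatorname{Var}[\psi_i(X)]<\infty$. The asymptotic Pearson correlation $\rho(T_i,T_j)$ is the correlation between the $i$-th and $j$-th coordinates of the limiting multivariate normal law, as $N\to\infty$, of the vector $\big(\sqrt{n_1^{(N)}}(T_1^{(N)}-\theta_1),\dots,\sqrt{n_C^{(N)}}(T_C^{(N)}-\theta_C)\big)$. *)

theory Defs
  imports "HOL-Probability.Probability"
begin

definition iid :: "'a measure \<Rightarrow> 'b measure \<Rightarrow> (nat \<Rightarrow> 'a \<Rightarrow> 'b) \<Rightarrow> bool" where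
  "iid M S X \<longleftrightarrow> prob_space.indep_vars M (\<lambda>_. S) X UNIV \<and>
     (\<forall>k. distr M S (X k) = distr M S (X 0))"

text \<open>The statistic \<open>T\<close> is a measurable function of the subsample indexed by \<open>D\<close>.\<close>

definition statistic_on ::
  "'a measure \<Rightarrow> 'b measure \<Rightarrow> (nat \<Rightarrow> 'a \<Rightarrow> 'b) \<Rightarrow> nat set \<Rightarrow> ('a \<Rightarrow> real) \<Rightarrow> bool" where
  "statistic_on M S X D T \<longleftrightarrow>
     (\<exists>g \<in> borel_measurable (Pi\<^sub>M D (\<lambda>_. S)). \<forall>w \<in> space M. T w = g (\<lambda>k\<in>D. X k w))"

definition tendsto_in_prob_0 :: "'a measure \<Rightarrow> (nat \<Rightarrow> 'a \<Rightarrow> real) \<Rightarrow> bool" where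
  "tendsto_in_prob_0 M Z \<longleftrightarrow>
     (\<forall>e>0. (\<lambda>N. measure M {w \<in> space M. \<bar>Z N w\<bar> > e}) \<longlonglongrightarrow> 0)"

definition small_o_p :: "'a measure \<Rightarrow> (nat \<Rightarrow> 'a \<Rightarrow> real) \<Rightarrow> (nat \<Rightarrow> real) \<Rightarrow> bool" where
  "small_o_p M Z a \<longleftrightarrow> tendsto_in_prob_0 M (\<lambda>N w. Z N w / a N)"

text \<open>\<open>X 0\<close> is the generic copy of the observations \<open>X 1, X 2, \<dots>\<close>. The integrability
  of \<open>\<psi>(X)\<close> is part of the condition that its expectation is zero, since the Bochner integral
  of a non-integrable function is zero by convention. Given that, finite variance is
  integrability of the squared deviation.\<close>

definition asymptotically_linear ::
  "'a measure \<Rightarrow> 'b measure \<Rightarrow> (nat \<Rightarrow> 'a \<Rightarrow> 'b) \<Rightarrow> (nat \<Rightarrow> nat set) \<Rightarrow>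
   (nat \<Rightarrow> 'a \<Rightarrow> real) \<Rightarrow> real \<Rightarrow> ('b \<Rightarrow> real) \<Rightarrow> bool" where
  "asymptotically_linear M S X D T \<theta> \<psi> \<longleftrightarrow>
     \<psi> \<in> borel_measurable S \<and>
     integrable M (\<lambda>w. \<psi> (X 0 w)) \<and>
     (\<integral>w. \<psi> (X 0 w) \<partial>M) = 0 \<and>
     integrable M (\<lambda>w. (\<psi> (X 0 w) - (\<integral>v. \<psi> (X 0 v) \<partial>M))\<^sup>2) \<and>
     small_o_p M
       (\<lambda>N w. (T N w - \<theta>) - 1 / real (card (D N)) * (\<Sum>k\<in>D N. \<psi> (X k w)))
       (\<lambda>N. real (card (D N)) powr (- 1 / 2))"

text \<open>Weak convergence on an arbitrary metric space; on the real line this is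
  \<open>weak_conv_m\<close>, see below.\<close>

definition weakly_converges ::
  "(nat \<Rightarrow> 'a::metric_space measure) \<Rightarrow> 'a measure \<Rightarrow> bool" where
  "weakly_converges \<mu> \<nu> \<longleftrightarrow>
     (\<forall>f :: 'a \<Rightarrow> real. continuous_on UNIV f \<longrightarrow> bounded (range f) \<longrightarrow>
        (\<lambda>N. \<integral>x. f x \<partial>\<mu> N) \<longlonglongrightarrow> (\<integral>x. f x \<partial>\<nu>))"

lemma weakly_converges_real_iff:
  assumes "\<And>N. real_distribution (\<mu> N)" and "real_distribution \<nu>"
  shows "weakly_converges \<mu> \<nu> \<longleftrightarrow> weak_conv_m \<mu> \<nu>"
proof
  assume "weakly_converges \<mu> \<nu>"
  then show "weak_conv_m \<mu> \<nu>"
    using assms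
    by (intro integral_bdd_continuous_conv_imp_weak_conv)
      (auto simp: weakly_converges_def bounded_iff continuous_on_eq_continuous_at)
next
  assume *: "weak_conv_m \<mu> \<nu>"
  show "weakly_converges \<mu> \<nu>"
    unfolding weakly_converges_def
  proof (intro allI impI)
    fix f :: "real \<Rightarrow> real"
    assume f: "continuous_on UNIV f" "bounded (range f)"
    then obtain B where "\<And>x. norm (f x) \<le> B"
      by (auto simp: bounded_iff)
    with f(1) show "(\<lambda>N. \<integral>x. f x \<partial>\<mu> N) \<longlonglongrightarrow> (\<integral>x. f x \<partial>\<nu>)"
      by (intro weak_conv_imp_integral_bdd_continuous_conv[OF assms *])
        (auto simp: continuous_on_eq_continuous_at)
  qed
qed

text \<open>Univariate normal laws, with the point masses as the case of zero variance.\<close>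

definition normal_law :: "real \<Rightarrow> real \<Rightarrow> real measure" where
  "normal_law m s = (if s = 0 then return borel m else density lborel (normal_density m s))"

text \<open>A law on Euclidean space is multivariate normal (possibly degenerate) if all its
  one-dimensional linear images are normal.\<close>

definition multivariate_normal :: "'v::euclidean_space measure \<Rightarrow> bool" where
  "multivariate_normal \<nu> \<longleftrightarrow> prob_space \<nu> \<and> sets \<nu> = sets borel \<and>
     (\<forall>a. \<exists>m s. s \<ge> 0 \<and> distr \<nu> borel (\<lambda>x. a \<bullet> x) = normal_law m s)"

definition covariance :: "'a measure \<Rightarrow> ('a \<Rightarrow> real) \<Rightarrow> ('a \<Rightarrow> real) \<Rightarrow> real" where
  "covariance M U V = (\<integral>w. (U w - (\<integral>v. U v \<partial>M)) * (V w - (\<integral>v. V v \<partial>M)) \<partial>M)"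

definition correlation :: "'a measure \<Rightarrow> ('a \<Rightarrow> real) \<Rightarrow> ('a \<Rightarrow> real) \<Rightarrow> real" where
  "correlation M U V = covariance M U V / sqrt (covariance M U U * covariance M V V)"

definition limiting_normal_law ::
  "'a measure \<Rightarrow> (nat \<Rightarrow> 'a \<Rightarrow> 'v::euclidean_space) \<Rightarrow> 'v measure \<Rightarrow> bool" where
  "limiting_normal_law M Y \<nu> \<longleftrightarrow>
     multivariate_normal \<nu> \<and> weakly_converges (\<lambda>N. distr M borel (Y N)) \<nu>"

text \<open>Meaningful only if there is exactly one limiting normal law.\<close>

definition asymptotic_correlation ::
  "'a measure \<Rightarrow> (nat \<Rightarrow> 'a \<Rightarrow> real ^ 'c) \<Rightarrow> 'c \<Rightarrow> 'c \<Rightarrow> real" where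
  "asymptotic_correlation M Y i j =
     correlation (THE \<nu>. limiting_normal_law M Y \<nu>) (\<lambda>x. x $ i) (\<lambda>x. x $ j)"

definition scaled_errors ::
  "('c \<Rightarrow> nat \<Rightarrow> nat) \<Rightarrow> ('c \<Rightarrow> real) \<Rightarrow> ('c \<Rightarrow> nat \<Rightarrow> 'a \<Rightarrow> real) \<Rightarrow>
   nat \<Rightarrow> 'a \<Rightarrow> real ^ 'c::finite" where
  "scaled_errors n \<theta> T N w = (\<chi> i. sqrt (real (n i N)) * (T i N w - \<theta> i))"

end

(*
  In terms of the influence functions, the scaled errors are, up to o_p(1),
    Z_i = n_i^(-1/2) * (sum of psi_i(X_k) over k in D_i).
  A linear combination of the Z_i is a sum over k of independent centred variables, and
  Cov(Z_i, Z_j) = |D_i inter D_j| / sqrt(n_i n_j) * E[psi_i psi_j] tends to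
  rho_ij * E[psi_i psi_j]. Lindeberg's argument gives convergence of the characteristic function
  of every linear combination, and the multivariate continuity theorem then gives weak convergence
  to the centred normal law with this covariance matrix. As rho_ii = 1, the first inequality is an
  equality; the second is Cauchy-Schwarz together with rho_ij >= 0.
*)

theory Submission
  imports Defs
begin

text \<open>Two gaps separate Lindeberg's argument from the claim. The first is one of dimension:
  Levy's continuity theorem concerns laws on the line, while the scaled errors have to be tested
  against every bounded continuous function on \<open>real ^ 'c\<close>. Cosines of affine forms
  bridge it: each of them sees a law only through one linear image, yet their sums approximate any
  continuous function on a box. Tails cost nothing extra, because they are dominated by a sum of
  ramps in single coordinates, and these are covered by Levy's theorem too. The second gap is that a
  normal law with covariance \<open>\<rho> i j * \<mu> i j\<close> must be known to exist, so this
  matrix must be positive semidefinite. That is read off from the central limit theorem itself: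
  \<open>exp (- q a / 2)\<close> is a limit of characteristic functions, hence at most 1. For this
  reason the limit theorem speaks of the number \<open>exp (- s / 2)\<close> and presupposes no
  limiting law. Finally, \<open>asymptotic_correlation\<close> picks its law by \<open>THE\<close>,
  so uniqueness of the weak limit has to be proved before any correlation can be computed.\<close>

section \<open>Trigonometric polynomials and approximation on boxes\<close>

text \<open>The phase \<open>b\<close> yields sines, and constants for \<open>a = 0\<close>, so one
  kind of generator suffices. Each generator depends on \<open>x\<close> through a single linear
  form, which is what reduces convergence of integrals to the line.\<close>

inductive_set trig_poly :: "('v::euclidean_space \<Rightarrow> real) set" where
  cos: "(\<lambda>x. r * cos (a \<bullet> x + b)) \<in> trig_poly"
| add: "f \<in> trig_poly \<Longrightarrow> g \<in> trig_poly \<Longrightarrow> (\<lambda>x. f x + g x) \<in> trig_poly"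

lemma trig_poly_const: "(\<lambda>x. c) \<in> trig_poly"
  using trig_poly.cos[of c 0 0] by simp

lemma trig_poly_sin: "(\<lambda>x. sin (a \<bullet> x)) \<in> trig_poly"
  using trig_poly.cos[of 1 "-a" "pi/2"] by (simp add: cos_diff cos_add algebra_simps)

lemma trig_poly_sum:
  "finite I \<Longrightarrow> (\<And>i. i \<in> I \<Longrightarrow> f i \<in> trig_poly) \<Longrightarrow> (\<lambda>x. \<Sum>i\<in>I. f i x) \<in> trig_poly"
  by (induction I rule: finite_induct) (auto intro: trig_poly_const trig_poly.add)

text \<open>Product-to-sum formula for two cosines, extended bilinearly. Closure under products
  allows sines to be substituted into an arbitrary polynomial.\<close>

lemma trig_poly_mult:
  assumes "f \<in> trig_poly" "g \<in> trig_poly"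
  shows "(\<lambda>x. f x * g x) \<in> trig_poly"
  using assms
proof (induction f arbitrary: g)
  case (cos r a b)
  from cos show ?case
  proof (induction g)
    case (cos r' a' b')
    have "(\<lambda>x. r * cos (a \<bullet> x + b) * (r' * cos (a' \<bullet> x + b')))
        = (\<lambda>x. r * r' / 2 * cos ((a - a') \<bullet> x + (b - b')) + r * r' / 2 * cos ((a + a') \<bullet> x + (b + b')))"
    proof
      fix x
      have "cos (a \<bullet> x + b) * cos (a' \<bullet> x + b')
        = (cos ((a \<bullet> x + b) - (a' \<bullet> x + b')) + cos ((a \<bullet> x + b) + (a' \<bullet> x + b'))) / 2"
        by (rule cos_times_cos)
      moreover have "(a \<bullet> x + b) - (a' \<bullet> x + b') = (a - a') \<bullet> x + (b - b')"
        "(a \<bullet> x + b) + (a' \<bullet> x + b') = (a + a') \<bullet> x + (b + b')"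
        by (simp_all add: inner_simps)
      ultimately have "cos (a \<bullet> x + b) * cos (a' \<bullet> x + b')
        = (cos ((a - a') \<bullet> x + (b - b')) + cos ((a + a') \<bullet> x + (b + b'))) / 2"
        by simp
      then show "r * cos (a \<bullet> x + b) * (r' * cos (a' \<bullet> x + b'))
        = r * r' / 2 * cos ((a - a') \<bullet> x + (b - b')) + r * r' / 2 * cos ((a + a') \<bullet> x + (b + b'))"
        by (simp add: field_simps)
    qed
    then show ?case
      by (simp only: trig_poly.add trig_poly.cos)
  next
    case (add f g)
    then show ?case
      using trig_poly.add by (fastforce simp: distrib_left)
  qed
next
  case (add f1 f2)
  then show ?case
    using trig_poly.add by (fastforce simp: distrib_right)
qed

lemma trig_poly_continuous: "f \<in> trig_poly \<Longrightarrow> continuous_on UNIV f"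
  by (induction rule: trig_poly.induct) (auto intro!: continuous_intros)

lemma trig_poly_bounded: "f \<in> trig_poly \<Longrightarrow> \<exists>B. \<forall>x. \<bar>f x\<bar> \<le> B"
proof (induction rule: trig_poly.induct)
  case (cos r a b)
  have "\<bar>r * cos (a \<bullet> x + b)\<bar> \<le> \<bar>r\<bar>" for x
    by (simp add: abs_mult mult_left_le)
  then show ?case by blast
next
  case (add f g)
  then obtain B C where "\<And>x. \<bar>f x\<bar> \<le> B" "\<And>x. \<bar>g x\<bar> \<le> C" by blast
  then have "\<bar>f x + g x\<bar> \<le> B + C" for x
    by (meson abs_triangle_ineq add_mono order_trans)
  then show ?case by blast
qed

text \<open>The substitution \<open>u = sin (c x)\<close>, applied to each coordinate, is invertible on a large box
  and maps the whole space into the unit box; hence a polynomial that is close to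
  \<open>f (arcsin u / c)\<close> on the unit box is, as a function of \<open>x\<close>, close to \<open>f\<close> on the large box and
  still bounded everywhere.\<close>

lemma trig_poly_approx:
  fixes f :: "'v::euclidean_space \<Rightarrow> real"
  assumes f: "continuous_on UNIV f" and B: "\<And>x. \<bar>f x\<bar> \<le> B" and e: "e > 0" and R: "R > 0"
  obtains p where "p \<in> trig_poly" "\<And>x. \<bar>p x\<bar> \<le> B + e"
    "\<And>x. (\<And>b. b \<in> Basis \<Longrightarrow> \<bar>x \<bullet> b\<bar> \<le> R) \<Longrightarrow> \<bar>f x - p x\<bar> \<le> e"
proof -
  \<comment> \<open>Chosen so that \<open>c * t\<close> stays in \<open>[-pi/2, pi/2]\<close> for
    \<open>\<bar>t\<bar> \<le> R\<close>, the range on which \<open>arcsin\<close> inverts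
    \<open>sin\<close>.\<close>
  define c where "c = pi / (2 * R)"
  have c: "c > 0" "c * R = pi / 2" using R by (auto simp: c_def)
  define h where "h u = f (\<Sum>b\<in>Basis. (arcsin (u \<bullet> b) / c) *\<^sub>R b)" for u :: 'v
  define u where "u x = (\<Sum>b\<in>Basis. sin ((c *\<^sub>R b) \<bullet> x) *\<^sub>R b)" for x :: 'v
  have ub: "u x \<bullet> b = sin (c * (x \<bullet> b))" if "b \<in> Basis" for x b
    using that by (simp add: u_def inner_commute[of _ x])
  have uin: "u x \<in> cbox (-One) One" for x
    by (auto simp: mem_box ub)
  have "continuous_on (cbox (-One) One) h"
    unfolding h_def
    by (intro continuous_on_compose2[OF f] continuous_intros) (use c in \<open>auto simp: mem_box\<close>)
  then obtain q where q: "real_polynomial_function q"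
      "\<And>v. v \<in> cbox (-One) One \<Longrightarrow> \<bar>h v - q v\<bar> < e"
    using Stone_Weierstrass_real_polynomial_function[OF compact_cbox, of "-One" One h e] e by blast
  have "(\<lambda>x. q (u x)) \<in> trig_poly"
    using q(1)
  proof (induction q)
    case (linear l)
    then interpret bounded_linear l .
    have "(\<lambda>x. l (u x)) = (\<lambda>x. \<Sum>b\<in>Basis. l b * sin ((c *\<^sub>R b) \<bullet> x))"
      unfolding u_def by (simp add: sum scale mult.commute)
    then show ?case
      by (auto intro!: trig_poly_sum trig_poly_mult trig_poly_const trig_poly_sin simp del: inner_scaleR_left)
  qed (auto intro: trig_poly_const trig_poly.add trig_poly_mult)
  moreover have "\<bar>q (u x)\<bar> \<le> B + e" for x
  proof -
    have "\<bar>h (u x)\<bar> \<le> B" by (simp add: h_def B)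
    then show ?thesis using q(2)[OF uin, of x] by linarith
  qed
  moreover have "\<bar>f x - q (u x)\<bar> \<le> e" if x: "\<And>b. b \<in> Basis \<Longrightarrow> \<bar>x \<bullet> b\<bar> \<le> R" for x
  proof -
    have "arcsin (u x \<bullet> b) / c = x \<bullet> b" if b: "b \<in> Basis" for b
    proof -
      have "\<bar>c * (x \<bullet> b)\<bar> \<le> c * R" using x[OF b] c by (simp add: abs_mult)
      then have "arcsin (sin (c * (x \<bullet> b))) = c * (x \<bullet> b)"
        using c by (intro arcsin_sin) auto
      then show ?thesis using c b by (simp add: ub)
    qed
    then have "(\<Sum>b\<in>Basis. (arcsin (u x \<bullet> b) / c) *\<^sub>R b) = (\<Sum>b\<in>Basis. (x \<bullet> b) *\<^sub>R b)"
      by (intro sum.cong) auto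
    then have "h (u x) = f x" by (simp add: h_def euclidean_representation)
    then show ?thesis using q(2)[OF uin, of x] by simp
  qed
  ultimately show ?thesis using that by blast
qed

section \<open>Uniqueness of weak limits\<close>

text \<open>Closed sets form an intersection-stable generator of the Borel sets, and the indicator
  of a closed \<open>C\<close> is the pointwise limit of the bounded continuous functions
  \<open>max 0 (1 - n * infdist x C)\<close>, whose integrals agree under both limits.\<close>

lemma weak_limit_unique:
  fixes \<nu> \<nu>' :: "'v::metric_space measure"
  assumes "prob_space \<nu>" "prob_space \<nu>'" and s: "sets \<nu> = sets borel" "sets \<nu>' = sets borel"
    and w: "weakly_converges \<mu> \<nu>" "weakly_converges \<mu> \<nu>'"
  shows "\<nu> = \<nu>'"
proof -
  interpret \<nu>: prob_space \<nu> by fact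
  interpret \<nu>': prob_space \<nu>' by fact
  have int: "(\<integral>x. f x \<partial>\<nu>) = (\<integral>x. f x \<partial>\<nu>')" if "continuous_on UNIV f" "bounded (range f)" for f :: "'v \<Rightarrow> real"
    using w that unfolding weakly_converges_def by (meson LIMSEQ_unique)
  have lim: "(\<lambda>n. \<integral>x. max 0 (1 - real n * infdist x C) \<partial>m) \<longlonglongrightarrow> measure m C"
    if "prob_space m" "sets m = sets borel" "closed C" "C \<noteq> {}" for m :: "'v measure" and C
  proof -
    interpret m: prob_space m by fact
    have Cm: "C \<in> sets m" using that by simp
    have "(\<lambda>n. \<integral>x. max 0 (1 - real n * infdist x C) \<partial>m) \<longlonglongrightarrow> (\<integral>x. indicator C x \<partial>m)"
    proof (rule integral_dominated_convergence[where w="\<lambda>_. 1"])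
      show "AE x in m. (\<lambda>n. max 0 (1 - real n * infdist x C)) \<longlonglongrightarrow> indicat_real C x"
      proof (rule AE_I2)
        fix x
        show "(\<lambda>n. max 0 (1 - real n * infdist x C)) \<longlonglongrightarrow> indicat_real C x"
        proof (cases "x \<in> C")
          case False
          then have "infdist x C > 0"
            using that(3,4) by (simp add: infdist_pos_not_in_closed)
          moreover have "eventually (\<lambda>n. real n > 1 / infdist x C) sequentially"
            using filterlim_real_sequentially unfolding filterlim_at_top_dense by blast
          ultimately have "eventually (\<lambda>n. max 0 (1 - real n * infdist x C) = 0) sequentially"
            by (auto elim!: eventually_mono simp: field_simps)
          then show ?thesis using False by (auto intro: tendsto_eventually)
        qed auto
      qed
      show "AE x in m. norm (max 0 (1 - real i * infdist x C)) \<le> 1" for i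
        by (auto simp: infdist_nonneg)
    next
      fix i
      have "(\<lambda>x. max 0 (1 - real i * infdist x C)) \<in> borel_measurable borel"
        by (intro borel_measurable_continuous_onI continuous_intros)
      then show "(\<lambda>x. max 0 (1 - real i * infdist x C)) \<in> borel_measurable m"
        using that(2) measurable_cong_sets by blast
    qed (use Cm in auto)
    then show ?thesis using Cm by simp
  qed
  \<comment> \<open>The empty set is split off because \<open>infdist x {}\<close> is 0 by
    convention, which would make the approximating functions constantly 1.\<close>
  have closed_eq: "emeasure \<nu> C = emeasure \<nu>' C" if "closed C" for C
  proof (cases "C = {}")
    case False
    have "(\<integral>x. max 0 (1 - real n * infdist x C) \<partial>\<nu>) = (\<integral>x. max 0 (1 - real n * infdist x C) \<partial>\<nu>')" for n
      by (intro int continuous_intros) (auto simp: bounded_iff infdist_nonneg intro!: exI[of _ 1])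
    then have "measure \<nu> C = measure \<nu>' C"
      using lim[OF \<nu>.prob_space_axioms s(1) that False] lim[OF \<nu>'.prob_space_axioms s(2) that False]
      by (metis (no_types, lifting) LIMSEQ_unique ext)
    then show ?thesis by (simp add: \<nu>.emeasure_eq_measure \<nu>'.emeasure_eq_measure)
  qed simp
  show ?thesis
  proof (rule measure_eqI_generator_eq[where E="Collect closed" and \<Omega>=UNIV and A="\<lambda>_. UNIV"])
    show "Int_stable (Collect closed :: 'v set set)" by (auto simp: Int_stable_def)
  qed (auto simp: closed_eq s borel_eq_closed sets_measure_of)
qed

section \<open>The continuity theorem on Euclidean space\<close>

lemma real_distribution_distr_inner:
  fixes m :: "'v::euclidean_space measure"
  assumes "prob_space m" "sets m = sets borel"
  shows "real_distribution (distr m borel (\<lambda>x. a \<bullet> x))"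
proof -
  have [measurable_cong]: "sets m = sets borel" by fact
  interpret prob_space m by fact
  show ?thesis by (intro real_distribution_distr) measurable
qed

lemma integrable_bounded_continuous:
  fixes m :: "'v::euclidean_space measure" and f :: "'v \<Rightarrow> real"
  assumes "prob_space m" "sets m = sets borel" "continuous_on UNIV f" "\<And>x. \<bar>f x\<bar> \<le> B"
  shows "integrable m f"
proof -
  interpret prob_space m by fact
  have "f \<in> borel_measurable borel" by (intro borel_measurable_continuous_onI assms)
  then have "f \<in> borel_measurable m" using assms(2) measurable_cong_sets by blast
  then show ?thesis by (intro integrable_const_bound[where B=B]) (auto simp: assms)
qed

text \<open>The integral of \<open>f\<close> is compared with that of a trigonometric polynomial
  \<open>p\<close> close to \<open>f\<close> on a large box. Outside the box the error is at most a
  constant times \<open>G\<close>, a sum of ramps in the coordinates. Integrals of \<open>p\<close>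
  and of \<open>G\<close> both converge by the one-dimensional theorem, and that of \<open>G\<close>
  under \<open>\<nu>\<close> is small for a large box; so tightness of \<open>\<mu>\<close> comes
  from its marginals.\<close>

theorem weakly_converges_of_characteristic:
  fixes \<mu> :: "nat \<Rightarrow> 'v::euclidean_space measure"
  assumes p\<mu>: "\<And>N. prob_space (\<mu> N)" and s\<mu>: "\<And>N. sets (\<mu> N) = sets borel"
    and p\<nu>: "prob_space \<nu>" and s\<nu>: "sets \<nu> = sets borel"
    and conv: "\<And>a. (\<lambda>N. CLINT x|\<mu> N. iexp (a \<bullet> x)) \<longlonglongrightarrow> (CLINT x|\<nu>. iexp (a \<bullet> x))"
  shows "weakly_converges \<mu> \<nu>"
proof -
  have char_inner: "char (distr m borel (\<lambda>x. a \<bullet> x)) t = (CLINT x|m. iexp ((t *\<^sub>R a) \<bullet> x))"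
    if "sets m = sets borel" for m :: "'v measure" and a t
  proof -
    have [measurable_cong]: "sets m = sets borel" by fact
    show ?thesis unfolding char_def by (subst integral_distr) auto
  qed
  have marginal: "(\<lambda>N. \<integral>x. g (a \<bullet> x) \<partial>\<mu> N) \<longlonglongrightarrow> (\<integral>x. g (a \<bullet> x) \<partial>\<nu>)"
    if g: "continuous_on UNIV g" "\<And>x. \<bar>g x\<bar> \<le> B" for g :: "real \<Rightarrow> real" and B a
  proof -
    have gm: "g \<in> borel_measurable borel" by (intro borel_measurable_continuous_onI g)
    have eq: "(\<integral>x. g x \<partial>(distr m borel (\<lambda>x. a \<bullet> x))) = (\<integral>x. g (a \<bullet> x) \<partial>m)"
      if "sets m = sets borel" for m :: "'v measure"
    proof -
      have [measurable_cong]: "sets m = sets borel" by fact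
      show ?thesis using gm by (subst integral_distr) auto
    qed
    \<comment> \<open>The characteristic function of the image under \<open>a\<close>, at
      \<open>t\<close>, is the multivariate one at \<open>t\<close> times \<open>a\<close>; hence
      \<open>conv\<close> along the line through \<open>a\<close> is the hypothesis of Levy's
      theorem.\<close>
    have "weak_conv_m (\<lambda>N. distr (\<mu> N) borel (\<lambda>x. a \<bullet> x)) (distr \<nu> borel (\<lambda>x. a \<bullet> x))"
      by (rule levy_continuity)
        (use assms in \<open>auto intro!: real_distribution_distr_inner simp: char_inner simp del: inner_scaleR_left\<close>)
    then have "(\<lambda>N. \<integral>x. g x \<partial>(distr (\<mu> N) borel (\<lambda>x. a \<bullet> x)))
        \<longlonglongrightarrow> (\<integral>x. g x \<partial>(distr \<nu> borel (\<lambda>x. a \<bullet> x)))"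
      by (intro weak_conv_imp_integral_bdd_continuous_conv[where B=B])
        (use g assms in \<open>auto intro!: real_distribution_distr_inner simp: continuous_on_eq_continuous_at\<close>)
    then show ?thesis using eq s\<mu> s\<nu> by simp
  qed
  have trig: "(\<lambda>N. \<integral>x. p x \<partial>\<mu> N) \<longlonglongrightarrow> (\<integral>x. p x \<partial>\<nu>)" if "p \<in> trig_poly" for p
    using that
  proof (induction p)
    case (cos r a b)
    have "continuous_on UNIV (\<lambda>y. r * cos (y + b))" by (intro continuous_intros)
    moreover have "\<bar>r * cos (y + b)\<bar> \<le> \<bar>r\<bar>" for y by (simp add: abs_mult mult_left_le)
    ultimately show ?case using marginal[of "\<lambda>y. r * cos (y + b)" "\<bar>r\<bar>" a] by blast
  next
    case (add f g)
    then obtain A B where "\<And>x. \<bar>f x\<bar> \<le> A" "\<And>x. \<bar>g x\<bar> \<le> B" using trig_poly_bounded by meson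
    then have int: "integrable m f" "integrable m g" if "prob_space m" "sets m = sets borel" for m
      using that add trig_poly_continuous integrable_bounded_continuous by blast+
    show ?case
      using add int p\<mu> s\<mu> p\<nu> s\<nu> by (simp add: tendsto_add)
  qed
  show ?thesis
    unfolding weakly_converges_def
  proof (intro allI impI)
    fix f :: "'v \<Rightarrow> real" assume f: "continuous_on UNIV f" "bounded (range f)"
    obtain B where B: "\<And>x. \<bar>f x\<bar> \<le> B" and B0: "B \<ge> 0"
      using f(2) by (auto simp: bounded_iff) (meson abs_ge_zero order_trans)
    \<comment> \<open>A continuous ramp: 0 for \<open>\<bar>y\<bar> \<le> R\<close> and 1 from
      \<open>R + 1\<close> on. This is why \<open>f\<close> is approximated on the box of half-width
      \<open>R + 1\<close> below.\<close>
    define g where "g R y = min 1 (max 0 (\<bar>y\<bar> - R))" for R y :: real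
    define G where "G R x = (\<Sum>b\<in>Basis. g R (b \<bullet> x))" for R and x :: 'v
    have g: "continuous_on UNIV (g R)" "\<bar>g R y\<bar> \<le> 1" "g R y \<ge> 0" for R y
      unfolding g_def by (auto intro!: continuous_intros)
    have gi: "integrable m (\<lambda>x. g R (b \<bullet> x))" if "prob_space m" "sets m = sets borel"
      for m :: "'v measure" and R b
    proof (rule integrable_bounded_continuous[OF that])
      show "continuous_on UNIV (\<lambda>x. g R (b \<bullet> x))"
        by (rule continuous_on_compose2[OF g(1)]) (auto intro!: continuous_intros)
    qed (rule g)
    have Gi: "integrable m (G R)" if "prob_space m" "sets m = sets borel" for m R
      unfolding G_def using gi[OF that] by auto
    have G0: "G R x \<ge> 0" for R x unfolding G_def by (intro sum_nonneg g)
    have G_conv: "(\<lambda>N. \<integral>x. G R x \<partial>\<mu> N) \<longlonglongrightarrow> (\<integral>x. G R x \<partial>\<nu>)" for R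
      unfolding G_def using gi p\<mu> s\<mu> p\<nu> s\<nu> marginal[OF g(1,2)] by (simp add: tendsto_sum)
    interpret \<nu>: prob_space \<nu> by fact
    have [measurable_cong]: "sets \<nu> = sets borel" by fact
    have "(\<lambda>n. \<integral>x. g (real n) (b \<bullet> x) \<partial>\<nu>) \<longlonglongrightarrow> (\<integral>x. 0 \<partial>\<nu>)" for b
    proof (rule integral_dominated_convergence[where w="\<lambda>_. 1"])
      show "AE x in \<nu>. (\<lambda>n. g (real n) (b \<bullet> x)) \<longlonglongrightarrow> 0"
      proof (rule AE_I2)
        fix x
        have "eventually (\<lambda>n. real n > \<bar>b \<bullet> x\<bar>) sequentially"
          using filterlim_real_sequentially unfolding filterlim_at_top_dense by blast
        then show "(\<lambda>n. g (real n) (b \<bullet> x)) \<longlonglongrightarrow> 0"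
          by (intro tendsto_eventually) (auto elim!: eventually_mono simp: g_def)
      qed
    qed (use g gi[OF p\<nu> s\<nu>] in auto)
    then have G_small: "(\<lambda>n. \<integral>x. G (real n) x \<partial>\<nu>) \<longlonglongrightarrow> 0"
      unfolding G_def using gi[OF p\<nu> s\<nu>] by (simp add: tendsto_null_sum)
    show "(\<lambda>N. \<integral>x. f x \<partial>\<mu> N) \<longlonglongrightarrow> (\<integral>x. f x \<partial>\<nu>)"
    proof (rule LIMSEQ_I)
      fix \<epsilon> :: real assume "\<epsilon> > 0"
      \<comment> \<open>The final estimate collects five errors of size at most \<open>e\<close>:
        two from approximation on the box, two from the tails and one from the convergence for
        \<open>p\<close>.\<close>
      define e where "e = \<epsilon> / 8"
      have e: "e > 0" "\<epsilon> = 8 * e" using \<open>\<epsilon> > 0\<close> by (auto simp: e_def)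
      \<comment> \<open>Bounds \<open>\<bar>f - p\<bar>\<close> everywhere, from
        \<open>\<bar>f\<bar> \<le> B\<close> and \<open>\<bar>p\<bar> \<le> B + e\<close>. It does
        not depend on the box, so the box can be chosen afterwards to push the tail below
        \<open>e / C\<close>.\<close>
      define C where "C = 2 * B + e"
      have C: "C > 0" using B0 e by (simp add: C_def)
      have "e / C > 0" using C e by simp
      then obtain n where n: "(\<integral>x. G (real n) x \<partial>\<nu>) < e / C"
        using order_tendstoD(2)[OF G_small] by (auto simp: eventually_sequentially)
      define R where "R = real n"
      obtain p where p: "p \<in> trig_poly" "\<And>x. \<bar>p x\<bar> \<le> B + e"
        "\<And>x. (\<And>b. b \<in> Basis \<Longrightarrow> \<bar>x \<bullet> b\<bar> \<le> R + 1) \<Longrightarrow> \<bar>f x - p x\<bar> \<le> e"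
        by (rule trig_poly_approx[OF f(1) B e(1), of "R + 1"]) (auto simp: R_def)
      have fp: "\<bar>f x - p x\<bar> \<le> e + C * G R x" for x
      proof (cases "\<forall>b\<in>Basis. \<bar>x \<bullet> b\<bar> \<le> R + 1")
        case True
        then show ?thesis using p(3)[of x] C G0[of R x]
          by (smt (verit) mult_nonneg_nonneg)
      next
        case False
        then obtain b where b: "b \<in> Basis" "\<bar>x \<bullet> b\<bar> > R + 1" by force
        then have "1 \<le> g R (b \<bullet> x)" by (simp add: g_def inner_commute)
        also have "\<dots> \<le> G R x" unfolding G_def using b by (intro member_le_sum) (auto simp: g)
        finally have "C * 1 \<le> C * G R x" using C by (intro mult_left_mono) auto
        moreover have "\<bar>f x - p x\<bar> \<le> C" using B[of x] p(2)[of x] unfolding C_def by linarith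
        ultimately show ?thesis using e by linarith
      qed
      have close: "\<bar>(\<integral>x. f x \<partial>m) - (\<integral>x. p x \<partial>m)\<bar> \<le> e + C * (\<integral>x. G R x \<partial>m)"
        if m: "prob_space m" "sets m = sets borel" for m
      proof -
        interpret prob_space m by fact
        have i: "integrable m f" "integrable m p" "integrable m (G R)"
          using integrable_bounded_continuous[OF m f(1) B] Gi[OF m]
            integrable_bounded_continuous[OF m trig_poly_continuous[OF p(1)] p(2)] by auto
        have "\<bar>(\<integral>x. f x \<partial>m) - (\<integral>x. p x \<partial>m)\<bar> \<le> (\<integral>x. \<bar>f x - p x\<bar> \<partial>m)"
          using i by (metis (no_types) Bochner_Integration.integral_diff integral_abs_bound)
        also have "\<dots> \<le> (\<integral>x. e + C * G R x \<partial>m)"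
          by (rule integral_mono) (use i fp in auto)
        also have "\<dots> = e + C * (\<integral>x. G R x \<partial>m)"
          using i by (simp add: prob_space)
        finally show ?thesis .
      qed
      have "eventually (\<lambda>N. (\<integral>x. G R x \<partial>\<mu> N) < e / C) sequentially"
        using n by (intro order_tendstoD(2)[OF G_conv]) (simp add: R_def)
      moreover have "eventually (\<lambda>N. \<bar>(\<integral>x. p x \<partial>\<mu> N) - (\<integral>x. p x \<partial>\<nu>)\<bar> < e) sequentially"
        using tendstoD[OF trig[OF p(1)] e(1)] by (simp add: dist_real_def)
      ultimately have "eventually (\<lambda>N. \<bar>(\<integral>x. f x \<partial>\<mu> N) - (\<integral>x. f x \<partial>\<nu>)\<bar> < \<epsilon>) sequentially"
      proof eventually_elim
        case (elim N)
        have "C * (\<integral>x. G R x \<partial>\<mu> N) < e" "C * (\<integral>x. G R x \<partial>\<nu>) < e"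
          using elim(1) n C by (simp_all add: R_def field_simps)
        then show ?case
          using close[OF p\<mu> s\<mu>, of N] close[OF p\<nu> s\<nu>] elim(2) e by linarith
      qed
      then show "\<exists>no. \<forall>N\<ge>no. norm ((\<integral>x. f x \<partial>\<mu> N) - (\<integral>x. f x \<partial>\<nu>)) < \<epsilon>"
        by (auto simp: eventually_sequentially)
    qed
  qed
qed

section \<open>Gaussian vectors with prescribed covariance\<close>

text \<open>Cholesky factorisation, one index at a time: eliminating the pivot \<open>k\<close>
  leaves the Schur complement \<open>B\<close> on \<open>I\<close>, which is again symmetric and
  positive semidefinite, and a factor of \<open>B\<close> extends to one of \<open>A\<close> by one
  column.\<close>

lemma psd_imp_gram:
  fixes A :: "'i \<Rightarrow> 'i \<Rightarrow> real"
  assumes "finite I" and "\<And>i j. A i j = A j i"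
    and "\<And>a. (\<Sum>i\<in>I. \<Sum>j\<in>I. a i * a j * A i j) \<ge> 0"
  shows "\<exists>L. \<forall>i\<in>I. \<forall>j\<in>I. A i j = (\<Sum>l\<in>I. L i l * L j l)"
  using assms
proof (induction I arbitrary: A rule: finite_induct)
  case empty
  show ?case by simp
next
  case (insert k I)
  note sym = insert.prems(1) and psd = insert.prems(2)
  have expand: "(\<Sum>i\<in>insert k I. \<Sum>j\<in>insert k I. a i * a j * A i j)
      = (\<Sum>i\<in>I. \<Sum>j\<in>I. a i * a j * A i j) + 2 * a k * (\<Sum>i\<in>I. a i * A i k) + (a k)\<^sup>2 * A k k" for a
  proof -
    have "(\<Sum>i\<in>I. a i * a k * A i k) = a k * (\<Sum>i\<in>I. a i * A i k)"
      unfolding sum_distrib_left by (intro sum.cong refl) (simp only: mult_ac)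
    moreover have "(\<Sum>i\<in>I. a k * a i * A k i) = a k * (\<Sum>i\<in>I. a i * A i k)"
      unfolding sum_distrib_left by (intro sum.cong refl) (simp only: sym[of k] mult.assoc mult.left_commute)
    moreover have "(\<Sum>i\<in>insert k I. \<Sum>j\<in>insert k I. a i * a j * A i j)
        = (a k * a k * A k k + (\<Sum>j\<in>I. a k * a j * A k j))
          + ((\<Sum>i\<in>I. a i * a k * A i k) + (\<Sum>i\<in>I. \<Sum>j\<in>I. a i * a j * A i j))"
      by (simp only: sum.insert[OF insert.hyps] sum.distrib)
    ultimately show ?thesis by (simp only: power2_eq_square)
  qed
  \<comment> \<open>With \<open>x / 0 = 0\<close>, the following covers also the degenerate pivot \<open>A k k = 0\<close>.\<close>
  define B where "B i j = A i j - A i k * A j k / A k k" for i j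
  have "(\<Sum>i\<in>I. \<Sum>j\<in>I. a i * a j * B i j) \<ge> 0" for a
  proof -
    define s where "s = (\<Sum>i\<in>I. a i * A i k)"
    have ss: "(\<Sum>i\<in>I. \<Sum>j\<in>I. (a i * A i k) * (a j * A j k)) = s * s"
      unfolding s_def by (simp only: sum_product)
    have "(\<Sum>i\<in>I. \<Sum>j\<in>I. a i * a j * B i j)
        = (\<Sum>i\<in>I. \<Sum>j\<in>I. a i * a j * A i j - (a i * A i k) * (a j * A j k) / A k k)"
      unfolding B_def by (intro sum.cong refl) (simp add: algebra_simps)
    also have "\<dots> = (\<Sum>i\<in>I. \<Sum>j\<in>I. a i * a j * A i j) - s * s / A k k"
      unfolding ss[symmetric] by (simp only: sum_subtractf sum_divide_distrib)
    finally have "(\<Sum>i\<in>I. \<Sum>j\<in>I. a i * a j * B i j)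
        = (\<Sum>i\<in>I. \<Sum>j\<in>I. a i * a j * A i j) - s * s / A k k" .
    moreover have "0 \<le> (\<Sum>i\<in>I. \<Sum>j\<in>I. a i * a j * A i j) + 2 * (- s / A k k) * s + (- s / A k k)\<^sup>2 * A k k"
    proof -
      \<comment> \<open>For a positive pivot this entry minimises the form of \<open>A\<close> over
        the coordinate \<open>k\<close>, and the minimum is the form of \<open>B\<close> at
        \<open>a\<close>. For a zero pivot the entry is 0 and \<open>B\<close> equals
        \<open>A\<close>.\<close>
      define u where "u = a(k := - s / A k k)"
      have uk: "u k = - s / A k k" by (simp add: u_def)
      have uI: "u i = a i" if "i \<in> I" for i using insert.hyps that by (auto simp: u_def)
      have 1: "(\<Sum>i\<in>I. \<Sum>j\<in>I. u i * u j * A i j) = (\<Sum>i\<in>I. \<Sum>j\<in>I. a i * a j * A i j)"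
        by (intro sum.cong refl) (simp only: uI)
      have 2: "(\<Sum>i\<in>I. u i * A i k) = s"
        unfolding s_def by (intro sum.cong refl) (simp only: uI)
      show ?thesis using psd[of u] by (simp only: expand 1 2 uk)
    qed
    ultimately show ?thesis
      by (cases "A k k = 0") (simp_all add: power2_eq_square)
  qed
  moreover have "B i j = B j i" for i j
    unfolding B_def by (simp only: sym[of i j] mult.commute[of "A i k"])
  ultimately obtain L where L: "\<And>i j. i \<in> I \<Longrightarrow> j \<in> I \<Longrightarrow> B i j = (\<Sum>l\<in>I. L i l * L j l)"
    using insert.IH[of B] by blast
  have diag: "A k k \<ge> 0"
  proof -
    define u where "u i = (if i = k then 1 else (0::real))" for i
    have u: "u k = 1" "\<And>i. i \<in> I \<Longrightarrow> u i = 0" using insert.hyps by (auto simp: u_def)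
    have 1: "(\<Sum>i\<in>I. \<Sum>j\<in>I. u i * u j * A i j) = 0" and 2: "(\<Sum>i\<in>I. u i * A i k) = 0"
      using u(2) by simp_all
    have "0 \<le> 0 + 2 * 1 * 0 + 1\<^sup>2 * A k k"
      using psd[of u] by (simp only: expand 1 2 u(1))
    then show ?thesis by simp
  qed
  \<comment> \<open>With a zero pivot the form at \<open>j\<close> plus \<open>t\<close> times
    \<open>k\<close> is affine in \<open>t\<close>. A nonzero slope would make it negative; the
    \<open>t\<close> used below gives the value -1.\<close>
  have null: "A j k = 0" if "A k k = 0" "j \<in> I" for j
  proof (rule ccontr)
    assume nz: "A j k \<noteq> 0"
    define u where "u t i = (if i = k then t else if i = j then 1 else (0::real))" for t i
    have uk: "u t k = t" for t by (simp add: u_def)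
    have uI: "u t i = (if i = j then 1 else 0)" if "i \<in> I" for t i
      using insert.hyps that by (auto simp: u_def)
    have "(\<Sum>i\<in>I. u t i * A i k) = (\<Sum>i\<in>I. if i = j then A i k else 0)" for t
      by (intro sum.cong refl) (simp add: uI)
    then have 1: "(\<Sum>i\<in>I. u t i * A i k) = A j k" for t
      using \<open>j \<in> I\<close> insert.hyps by simp
    have "(\<Sum>i\<in>I. \<Sum>l\<in>I. u t i * u t l * A i l) = (\<Sum>i\<in>I. if i = j then (\<Sum>l\<in>I. if l = j then A i l else 0) else 0)" for t
      by (intro sum.cong refl) (auto simp: uI intro!: sum.cong)
    then have 2: "(\<Sum>i\<in>I. \<Sum>l\<in>I. u t i * u t l * A i l) = A j j" for t
      using \<open>j \<in> I\<close> insert.hyps by simp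
    have "0 \<le> A j j + 2 * t * A j k + t\<^sup>2 * 0" for t
      using psd[of "u t"] by (simp only: expand 1 2 uk that(1))
    from this[of "- (A j j + 1) / (2 * A j k)"] nz show False by (simp add: field_simps)
  qed
  have sq: "sqrt (A k k) * sqrt (A k k) = A k k" using diag by simp
  \<comment> \<open>The new column is the normalised pivot column, and row \<open>k\<close> has no
    entry in the old columns. For a zero pivot the new column is 0 by division by zero, consistently
    with \<open>null\<close>.\<close>
  define L' where "L' i l = (if l = k then A i k / sqrt (A k k) else if i = k then 0 else L i l)" for i l
  have "A i j = (\<Sum>l\<in>insert k I. L' i l * L' j l)" if ij: "i \<in> insert k I" "j \<in> insert k I" for i j
  proof -
    have split: "(\<Sum>l\<in>insert k I. L' i l * L' j l)
        = A i k * A j k / A k k + (\<Sum>l\<in>I. if i = k \<or> j = k then 0 else L i l * L j l)"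
    proof -
      have "(\<Sum>l\<in>I. L' i l * L' j l) = (\<Sum>l\<in>I. if i = k \<or> j = k then 0 else L i l * L j l)"
        using insert.hyps by (intro sum.cong) (auto simp: L'_def)
      moreover have "L' i k * L' j k = A i k * A j k / A k k"
        unfolding L'_def using diag by (simp add: sq)
      ultimately show ?thesis using insert.hyps by simp
    qed
    show ?thesis
    proof (cases "i = k \<or> j = k")
      case True
      then show ?thesis
        unfolding split using null[of i] null[of j] ij sym[of i j]
        by (cases "A k k = 0") auto
    next
      case False
      then show ?thesis unfolding split using L[of i j] ij by (simp add: B_def)
    qed
  qed
  then show ?case by blast
qed

text \<open>As an image of the standard normal law, the point mass \<open>s = 0\<close> is treated
  together with the densities in all moment and characteristic function computations.\<close>

lemma normal_law_zero_mean:
  assumes "s \<ge> 0"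
  shows "normal_law 0 s = distr std_normal_distribution borel (\<lambda>x. s * x)"
proof (cases "s = 0")
  case True
  interpret real_distribution std_normal_distribution by (rule real_dist_normal_dist)
  show ?thesis using True by (simp add: normal_law_def distr_const)
next
  case False
  interpret real_distribution std_normal_distribution by (rule real_dist_normal_dist)
  have "distributed std_normal_distribution lborel (\<lambda>x. x) (normal_density 0 1)"
    unfolding distributed_def by (auto simp: distr_id2)
  then have "distributed std_normal_distribution lborel (\<lambda>x. 0 + s * x) (normal_density (0 + s * 0) (\<bar>s\<bar> * 1))"
    by (rule normal_density_affine) (use False in auto)
  then have "distr std_normal_distribution lborel (\<lambda>x. s * x) = density lborel (normal_density 0 s)"
    using assms by (simp add: distributed_def)
  moreover have "distr std_normal_distribution lborel (\<lambda>x. s * x) = distr std_normal_distribution borel (\<lambda>x. s * x)"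
    by (rule distr_cong) auto
  ultimately show ?thesis using False by (simp add: normal_law_def)
qed

lemma
  assumes "s \<ge> 0"
  shows real_distribution_normal_law: "real_distribution (normal_law 0 s)"
    and char_normal_law: "char (normal_law 0 s) t = complex_of_real (exp (- (t * s)\<^sup>2 / 2))"
    and normal_law_mean: "(\<integral>x. x \<partial>normal_law 0 s) = 0"
    and normal_law_second_moment: "(\<integral>x. x\<^sup>2 \<partial>normal_law 0 s) = s\<^sup>2"
    and integrable_normal_law_square: "integrable (normal_law 0 s) (\<lambda>x. x\<^sup>2)"
proof -
  note eq = normal_law_zero_mean[OF assms]
  interpret real_distribution std_normal_distribution by (rule real_dist_normal_dist)
  show "real_distribution (normal_law 0 s)" unfolding eq by (rule real_distribution_distr) simp
  have "char (normal_law 0 s) t = char std_normal_distribution (t * s)"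
    unfolding eq char_def by (subst integral_distr) (simp_all add: mult.assoc)
  then show "char (normal_law 0 s) t = complex_of_real (exp (- (t * s)\<^sup>2 / 2))"
    by (simp add: char_std_normal_distribution)
  have m: "(\<integral>x. x \<partial>std_normal_distribution) = 0" "(\<integral>x. x\<^sup>2 \<partial>std_normal_distribution) = 1"
    using integral_std_normal_distribution_moment_odd[of 1] std_normal_distribution_even_moments(1)[of 1]
    by simp_all
  have i: "integrable std_normal_distribution (\<lambda>x. x\<^sup>2)"
    by (rule integrable_std_normal_distribution_moment)
  have mi: "(\<lambda>x. x) \<in> borel_measurable (borel::real measure)"
    "(\<lambda>x. x\<^sup>2) \<in> borel_measurable (borel::real measure)" by simp_all
  have ms: "(\<lambda>x. s * x) \<in> measurable std_normal_distribution borel" by simp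
  show "(\<integral>x. x \<partial>normal_law 0 s) = 0"
    unfolding eq by (subst integral_distr[OF ms]) (simp_all only: mi integral_mult_right_zero m mult_zero_right)
  show "(\<integral>x. x\<^sup>2 \<partial>normal_law 0 s) = s\<^sup>2"
    unfolding eq by (subst integral_distr[OF ms])
      (simp_all only: mi power_mult_distrib integral_mult_right_zero m mult_1_right)
  show "integrable (normal_law 0 s) (\<lambda>x. x\<^sup>2)"
    unfolding eq by (subst integrable_distr_eq[OF ms])
      (simp_all only: mi power_mult_distrib integrable_mult_right[OF i])
qed

text \<open>By independence the factors \<open>exp (- (t * c l)\<^sup>2 / 2)\<close> multiply, which
  adds the squares of the coefficients; Levy's uniqueness theorem identifies the law.\<close>

lemma distr_linear_combination_std_normal:
  fixes c :: "'i::finite \<Rightarrow> real"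
  shows "distr (Pi\<^sub>M UNIV (\<lambda>_. std_normal_distribution)) borel (\<lambda>w. \<Sum>l\<in>UNIV. c l * w l)
    = normal_law 0 (sqrt (\<Sum>l\<in>UNIV. (c l)\<^sup>2))"
proof -
  let ?P = "Pi\<^sub>M UNIV (\<lambda>_::'i. std_normal_distribution)"
  interpret N: real_distribution std_normal_distribution by (rule real_dist_normal_dist)
  interpret P: prob_space ?P by (intro prob_space_PiM N.prob_space_axioms)
  have comp: "distr ?P std_normal_distribution (\<lambda>w. w l) = std_normal_distribution" for l
    by (rule distr_PiM_component) (auto intro: N.prob_space_axioms)
  have comp': "distr ?P borel (\<lambda>w. w l) = std_normal_distribution" for l
    using comp[of l] by (metis (no_types, lifting) distr_cong sets_density sets_lborel)
  have rv: "(\<lambda>w. w l) \<in> borel_measurable ?P" for l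
    using measurable_component_singleton[of l UNIV "\<lambda>_. std_normal_distribution"] by simp
  have "P.indep_vars (\<lambda>_. std_normal_distribution) (\<lambda>l w. w l) UNIV"
  proof (subst P.indep_vars_iff_distr_eq_PiM')
    show "distr ?P ?P (\<lambda>x. \<lambda>i\<in>UNIV. x i) = Pi\<^sub>M UNIV (\<lambda>i. distr ?P std_normal_distribution (\<lambda>w. w i))"
      by (simp only: comp restrict_UNIV) (rule distr_id2, simp)
  qed auto
  then have indep: "P.indep_vars (\<lambda>_. borel) (\<lambda>l w. c l * w l) UNIV"
    by (rule P.indep_vars_compose2) auto
  have char1: "char (distr ?P borel (\<lambda>w. c l * w l)) t = complex_of_real (exp (- (t * c l)\<^sup>2 / 2))" for l t
  proof -
    have "char (distr ?P borel (\<lambda>w. c l * w l)) t = char (distr ?P borel (\<lambda>w. w l)) (t * c l)"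
      unfolding char_def using rv by (subst (1 2) integral_distr) (auto simp: mult_ac)
    then show ?thesis by (simp add: comp' char_std_normal_distribution)
  qed
  show ?thesis
  proof (rule Levy_uniqueness)
    show "real_distribution (distr ?P borel (\<lambda>w. \<Sum>l\<in>UNIV. c l * w l))"
      using rv by (intro P.real_distribution_distr) auto
    show "real_distribution (normal_law 0 (sqrt (\<Sum>l\<in>UNIV. (c l)\<^sup>2)))"
      by (intro real_distribution_normal_law) (auto intro: sum_nonneg)
    show "char (distr ?P borel (\<lambda>w. \<Sum>l\<in>UNIV. c l * w l)) = char (normal_law 0 (sqrt (\<Sum>l\<in>UNIV. (c l)\<^sup>2)))"
    proof
      fix t
      have "(\<Sum>l\<in>UNIV. - (t * c l)\<^sup>2 / 2) = - (t * sqrt (\<Sum>l\<in>UNIV. (c l)\<^sup>2))\<^sup>2 / 2"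
        by (simp add: power_mult_distrib sum_nonneg sum_negf sum_distrib_left sum_divide_distrib)
      then show "char (distr ?P borel (\<lambda>w. \<Sum>l\<in>UNIV. c l * w l)) t
          = char (normal_law 0 (sqrt (\<Sum>l\<in>UNIV. (c l)\<^sup>2))) t"
        unfolding P.char_distr_sum[OF indep] char1
        by (subst char_normal_law) (auto simp: sum_nonneg simp flip: exp_sum of_real_prod)
    qed
  qed
qed

text \<open>The law is that of \<open>L\<close> applied to a vector of independent standard normals,
  where \<open>A\<close> is the Gram matrix of the rows of \<open>L\<close>.\<close>

theorem gaussian_exists:
  fixes A :: "'c::finite \<Rightarrow> 'c \<Rightarrow> real"
  assumes sym: "\<And>i j. A i j = A j i" and psd: "\<And>a. (\<Sum>i\<in>UNIV. \<Sum>j\<in>UNIV. a i * a j * A i j) \<ge> 0"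
  obtains \<nu> :: "(real ^ 'c) measure" where "prob_space \<nu>" "sets \<nu> = sets borel"
    "\<And>a. distr \<nu> borel (\<lambda>x. a \<bullet> x) = normal_law 0 (sqrt (\<Sum>i\<in>UNIV. \<Sum>j\<in>UNIV. a $ i * a $ j * A i j))"
proof -
  obtain L where L: "\<And>i j. A i j = (\<Sum>l\<in>(UNIV::'c set). L i l * L j l)"
    using psd_imp_gram[of UNIV A, OF finite sym psd] by blast
  let ?P = "Pi\<^sub>M UNIV (\<lambda>_::'c. std_normal_distribution)"
  interpret N: real_distribution std_normal_distribution by (rule real_dist_normal_dist)
  interpret P: prob_space ?P by (intro prob_space_PiM N.prob_space_axioms)
  have rv[measurable]: "(\<lambda>w. w l) \<in> borel_measurable ?P" for l
    using measurable_component_singleton[of l UNIV "\<lambda>_. std_normal_distribution"] by simp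
  define X where "X w = (\<chi> i. \<Sum>l\<in>UNIV. L i l * w l)" for w
  have X[measurable]: "X \<in> borel_measurable ?P"
    unfolding X_def by (subst borel_measurable_euclidean_space) (auto simp: Basis_vec_def inner_axis)
  have "distr (distr ?P borel X) borel (\<lambda>x. a \<bullet> x)
      = normal_law 0 (sqrt (\<Sum>i\<in>UNIV. \<Sum>j\<in>UNIV. a $ i * a $ j * A i j))" for a
  proof -
    have "a \<bullet> X w = (\<Sum>l\<in>UNIV. (\<Sum>i\<in>UNIV. a $ i * L i l) * w l)" for w
      unfolding X_def inner_vec_def
      by (simp add: sum_distrib_left sum_distrib_right mult_ac) (rule sum.swap)
    then have "distr (distr ?P borel X) borel (\<lambda>x. a \<bullet> x)
        = normal_law 0 (sqrt (\<Sum>l\<in>UNIV. (\<Sum>i\<in>UNIV. a $ i * L i l)\<^sup>2))"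
      by (subst distr_distr) (auto simp: comp_def distr_linear_combination_std_normal)
    also have "(\<Sum>l\<in>UNIV. (\<Sum>i\<in>UNIV. a $ i * L i l)\<^sup>2)
        = (\<Sum>l\<in>UNIV. \<Sum>i\<in>UNIV. \<Sum>j\<in>UNIV. a $ i * a $ j * (L i l * L j l))"
      by (simp add: power2_eq_square sum_product mult_ac)
    also have "\<dots> = (\<Sum>i\<in>UNIV. \<Sum>l\<in>UNIV. \<Sum>j\<in>UNIV. a $ i * a $ j * (L i l * L j l))"
      by (rule sum.swap)
    also have "\<dots> = (\<Sum>i\<in>UNIV. \<Sum>j\<in>UNIV. \<Sum>l\<in>UNIV. a $ i * a $ j * (L i l * L j l))"
      by (intro sum.cong refl sum.swap)
    also have "\<dots> = (\<Sum>i\<in>UNIV. \<Sum>j\<in>UNIV. a $ i * a $ j * A i j)"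
      by (simp add: L sum_distrib_left)
    finally show ?thesis .
  qed
  moreover have "prob_space (distr ?P borel X)" by (rule P.prob_space_distr) simp
  ultimately show ?thesis using that by auto
qed

section \<open>Lindeberg's theorem for triangular arrays\<close>

lemma abs_exp_minus_linear_le:
  fixes x :: real
  assumes "x \<ge> 0"
  shows "\<bar>exp (- x) - (1 - x)\<bar> \<le> x\<^sup>2"
proof -
  have "1 - x \<le> exp (- x)" using exp_ge_add_one_self[of "- x"] by simp
  moreover have "exp (- x) \<le> 1 / (1 + x)"
    using exp_ge_add_one_self[of x] assms by (simp add: exp_minus field_simps)
  moreover have "1 / (1 + x) \<le> 1 - x + x\<^sup>2"
  proof -
    have "(1 - x + x\<^sup>2) * (1 + x) = 1 + x ^ 3" by (simp add: algebra_simps power2_eq_square power3_eq_cube)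
    moreover have "x ^ 3 \<ge> 0" using assms by simp
    ultimately have "1 \<le> (1 - x + x\<^sup>2) * (1 + x)" by simp
    then show ?thesis using assms by (simp add: divide_le_eq)
  qed
  ultimately show ?thesis by linarith
qed

text \<open>Each factor is replaced by \<open>exp (- v / 2)\<close>. All factors have modulus at
  most 1, so the error of the product is at most the sum of the single errors: the second-order
  Taylor remainder \<open>h / 6\<close>, plus at most \<open>v * v\<close> for passing from
  \<open>1 - v / 2\<close> to the exponential. Thus \<open>lind\<close> is Lindeberg's condition in
  the shape of the Taylor remainder, and \<open>small\<close> makes the sum of the
  \<open>v * v\<close> vanish.\<close>

lemma (in prob_space) lindeberg_char_tendsto:
  fixes V :: "nat \<Rightarrow> 'i \<Rightarrow> 'a \<Rightarrow> real"
  assumes indep: "\<And>N. indep_vars (\<lambda>_. borel) (V N) (I N)"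
    and int: "\<And>N k. k \<in> I N \<Longrightarrow> integrable M (V N k)"
    and int2: "\<And>N k. k \<in> I N \<Longrightarrow> integrable M (\<lambda>w. (V N k w)\<^sup>2)"
    and mean: "\<And>N k. k \<in> I N \<Longrightarrow> expectation (V N k) = 0"
    and var: "(\<lambda>N. \<Sum>k\<in>I N. expectation (\<lambda>w. (V N k w)\<^sup>2)) \<longlonglongrightarrow> s"
    and lind: "(\<lambda>N. \<Sum>k\<in>I N. expectation (\<lambda>w. min (6 * (V N k w)\<^sup>2) (\<bar>V N k w\<bar> ^ 3))) \<longlonglongrightarrow> 0"
    and small: "\<And>N k. k \<in> I N \<Longrightarrow> expectation (\<lambda>w. (V N k w)\<^sup>2) \<le> m N" "m \<longlonglongrightarrow> 0"
  shows "(\<lambda>N. char (distr M borel (\<lambda>w. \<Sum>k\<in>I N. V N k w)) 1) \<longlonglongrightarrow> complex_of_real (exp (- s / 2))"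
proof -
  define v where "v N k = expectation (\<lambda>w. (V N k w)\<^sup>2)" for N k
  define h where "h N k = expectation (\<lambda>w. min (6 * (V N k w)\<^sup>2) (\<bar>V N k w\<bar> ^ 3))" for N k
  define c where "c N k = char (distr M borel (V N k)) 1" for N k
  have rv: "random_variable borel (V N k)" if "k \<in> I N" for N k
    using indep[of N] that unfolding indep_vars_def2 by auto
  have v0: "v N k \<ge> 0" for N k by (simp add: v_def)
  have prod: "char (distr M borel (\<lambda>w. \<Sum>k\<in>I N. V N k w)) 1 = (\<Prod>k\<in>I N. c N k)" for N
    unfolding c_def by (rule char_distr_sum[OF indep])
  have single: "norm (c N k - complex_of_real (exp (- (v N k / 2)))) \<le> h N k / 6 + m N * v N k" if k: "k \<in> I N" for N k
  proof -
    have "norm (c N k - (1 - 1\<^sup>2 * v N k / 2)) \<le> (1\<^sup>2 / 6) * expectation (\<lambda>w. min (6 * (V N k w)\<^sup>2) (\<bar>1\<bar> * \<bar>V N k w\<bar> ^ 3))"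
      unfolding c_def
      by (rule char_approx3') (use rv[OF k] int[OF k] int2[OF k] mean[OF k] in \<open>auto simp: v_def\<close>)
    then have 1: "norm (c N k - complex_of_real (1 - v N k / 2)) \<le> h N k / 6" by (simp add: h_def)
    have "norm (complex_of_real (1 - v N k / 2) - complex_of_real (exp (- (v N k / 2))))
        = \<bar>exp (- (v N k / 2)) - (1 - v N k / 2)\<bar>"
      by (simp only: of_real_diff[symmetric] norm_of_real abs_minus_commute)
    also have "\<dots> \<le> (v N k / 2)\<^sup>2" by (rule abs_exp_minus_linear_le) (simp add: v0)
    also have "\<dots> \<le> v N k * v N k" using v0[of N k] by (simp add: power2_eq_square)
    also have "\<dots> \<le> m N * v N k" using small(1)[OF k] v0 by (intro mult_right_mono) (simp_all add: v_def)
    finally have 2: "norm (complex_of_real (1 - v N k / 2) - complex_of_real (exp (- (v N k / 2)))) \<le> m N * v N k" .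
    show ?thesis using norm_diff_triangle_le[OF 1 2] .
  qed
  have bound: "norm ((\<Prod>k\<in>I N. c N k) - complex_of_real (exp (- (\<Sum>k\<in>I N. v N k) / 2)))
      \<le> (\<Sum>k\<in>I N. h N k) / 6 + m N * (\<Sum>k\<in>I N. v N k)" for N
  \<comment> \<open>For infinite \<open>I N\<close> the product is 1 and the sums are 0 by
    convention, so both sides are 0.\<close>
  proof (cases "finite (I N)")
    case True
    have "complex_of_real (exp (- (\<Sum>k\<in>I N. v N k) / 2)) = (\<Prod>k\<in>I N. complex_of_real (exp (- (v N k / 2))))"
      using True by (simp add: exp_sum sum_divide_distrib flip: of_real_prod sum_negf)
    moreover have "norm ((\<Prod>k\<in>I N. c N k) - (\<Prod>k\<in>I N. complex_of_real (exp (- (v N k / 2)))))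
        \<le> (\<Sum>k\<in>I N. norm (c N k - complex_of_real (exp (- (v N k / 2)))))"
    proof (rule norm_prod_diff)
      show "norm (c N k) \<le> 1" if "k \<in> I N" for k
      proof -
        interpret D: real_distribution "distr M borel (V N k)" by (rule real_distribution_distr[OF rv[OF that]])
        show ?thesis unfolding c_def by (rule D.cmod_char_le_1)
      qed
    qed (simp add: v0)
    moreover have "(\<Sum>k\<in>I N. norm (c N k - complex_of_real (exp (- (v N k / 2))))) \<le> (\<Sum>k\<in>I N. h N k / 6 + m N * v N k)"
      by (rule sum_mono) (rule single)
    ultimately show ?thesis by (simp add: sum.distrib sum_distrib_left sum_divide_distrib)
  qed simp
  have "(\<lambda>N. (\<Sum>k\<in>I N. h N k) / 6 + m N * (\<Sum>k\<in>I N. v N k)) \<longlonglongrightarrow> 0 / 6 + 0 * s"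
    unfolding h_def v_def by (intro tendsto_intros lind small(2) var) simp
  then have lim: "(\<lambda>N. (\<Sum>k\<in>I N. h N k) / 6 + m N * (\<Sum>k\<in>I N. v N k)) \<longlonglongrightarrow> 0"
    by simp
  have "(\<lambda>N. (\<Prod>k\<in>I N. c N k) - complex_of_real (exp (- (\<Sum>k\<in>I N. v N k) / 2))) \<longlonglongrightarrow> 0"
    by (rule Lim_null_comparison[OF always_eventually lim]) (rule allI, rule bound)
  moreover have "(\<lambda>N. complex_of_real (exp (- (\<Sum>k\<in>I N. v N k) / 2))) \<longlonglongrightarrow> complex_of_real (exp (- s / 2))"
    unfolding v_def by (intro tendsto_intros var) simp
  ultimately show ?thesis unfolding prod by (rule Lim_transform[rotated])
qed


section \<open>The central limit theorem for overlapping samples\<close>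

lemma square_sum_le:
  fixes x :: "'c::finite \<Rightarrow> real"
  shows "(\<Sum>i\<in>UNIV. x i)\<^sup>2 \<le> real CARD('c) * (\<Sum>i\<in>UNIV. (x i)\<^sup>2)"
  using sum_squared_le_sum_of_squares[of x UNIV] by (simp add: mult.commute)

lemma integrable_product_of_squares:
  fixes f g :: "'a \<Rightarrow> real"
  assumes "f \<in> borel_measurable M" "g \<in> borel_measurable M"
    and "integrable M (\<lambda>x. (f x)\<^sup>2)" "integrable M (\<lambda>x. (g x)\<^sup>2)"
  shows "integrable M (\<lambda>x. f x * g x)"
proof (rule Bochner_Integration.integrable_bound)
  show "integrable M (\<lambda>x. (f x)\<^sup>2 + (g x)\<^sup>2)" using assms by simp
  have "\<bar>f x * g x\<bar> \<le> (f x)\<^sup>2 + (g x)\<^sup>2" for x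
  proof -
    have "0 \<le> (\<bar>f x\<bar> - \<bar>g x\<bar>)\<^sup>2" by simp
    then have "2 * \<bar>f x * g x\<bar> \<le> (f x)\<^sup>2 + (g x)\<^sup>2"
      unfolding power2_diff by (simp add: abs_mult)
    moreover have "0 \<le> \<bar>f x * g x\<bar>" by simp
    ultimately show ?thesis by linarith
  qed
  then show "AE x in M. norm (f x * g x) \<le> norm ((f x)\<^sup>2 + (g x)\<^sup>2)" by auto
qed (use assms in simp)

text \<open>Grouping by observation removes the dependence between samples: observation
  \<open>k\<close> contributes \<open>\<phi> N k (X k w)\<close>, where \<open>\<phi> N k\<close>
  adds up \<open>a i / d i N\<close> times \<open>\<psi> i\<close> over the samples containing
  \<open>k\<close>. These summands are independent but not identically distributed, so Lindeberg's
  condition is checked with an envelope \<open>G\<close> that is free of \<open>k\<close>; the sum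
  over \<open>k\<close> then only counts \<open>card (D i N)\<close> and cancels the
  normalisation.\<close>

lemma (in prob_space) clt_overlapping_samples:
  fixes D :: "'c::finite \<Rightarrow> nat \<Rightarrow> nat set" and \<psi> :: "'c \<Rightarrow> 'b \<Rightarrow> real"
  assumes indep: "indep_vars (\<lambda>_. S) X UNIV" and distr: "\<And>k::nat. distr M S (X k) = Q"
    and \<psi>[measurable]: "\<And>i. \<psi> i \<in> borel_measurable S"
    and int: "\<And>i. integrable Q (\<psi> i)" and int2: "\<And>i. integrable Q (\<lambda>x. (\<psi> i x)\<^sup>2)"
    and mean: "\<And>i. (\<integral>x. \<psi> i x \<partial>Q) = 0"
    and fin: "\<And>i N. finite (D i N)"
    and n: "\<And>i. filterlim (\<lambda>N. real (card (D i N))) at_top sequentially"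
    and \<rho>: "\<And>i j. (\<lambda>N. real (card (D i N \<inter> D j N)) / (sqrt (card (D i N)) * sqrt (card (D j N)))) \<longlonglongrightarrow> \<rho> i j"
  shows "(\<lambda>N. char (distr M borel (\<lambda>w. \<Sum>i\<in>UNIV. a i * ((\<Sum>k\<in>D i N. \<psi> i (X k w)) / sqrt (card (D i N))))) 1)
    \<longlonglongrightarrow> complex_of_real (exp (- (\<Sum>i\<in>UNIV. \<Sum>j\<in>UNIV. a i * a j * (\<rho> i j * (\<integral>x. \<psi> i x * \<psi> j x \<partial>Q))) / 2))"
proof -
  have X[measurable]: "X k \<in> measurable M S" for k using indep unfolding indep_vars_def2 by auto
  have setsQ[measurable_cong]: "sets Q = sets S" unfolding distr[of 0, symmetric] by simp
  have transfer: "expectation (\<lambda>w. g (X k w)) = (\<integral>x. g x \<partial>Q)" if "g \<in> borel_measurable S" for g :: "'b \<Rightarrow> real" and k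
    unfolding distr[of k, symmetric] by (rule integral_distr[symmetric]) (use that X in auto)
  have transfer_int: "integrable M (\<lambda>w. g (X k w))" if "integrable Q g" "g \<in> borel_measurable S" for g :: "'b \<Rightarrow> real" and k
    using that unfolding distr[of k, symmetric] by (simp add: integrable_distr_eq)
  define I where "I N = (\<Union>i. D i N)" for N
  have finI: "finite (I N)" for N unfolding I_def using fin by simp
  define d where "d i N = sqrt (card (D i N))" for i N
  have d0: "d i N \<ge> 0" for i N by (simp add: d_def)
  have d_top: "filterlim (d i) at_top sequentially" for i
    unfolding d_def by (rule filterlim_compose[OF sqrt_at_top n])
  have d_inv: "(\<lambda>N. b / d i N) \<longlonglongrightarrow> 0" for i b
    by (rule real_tendsto_divide_at_top[OF tendsto_const d_top])
  \<comment> \<open>Membership weights let all samples be summed over the common index set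
    \<open>I N\<close>. Being 0 or 1, they equal their squares, and the sum of a product of two of
    them is the size of the overlap.\<close>
  define u where "u i N k = indicat_real (D i N) k" for i N k
  have u01: "u i N k = 0 \<or> u i N k = 1" for i N k by (simp add: u_def indicator_def)
  have u_sum: "(\<Sum>k\<in>I N. u i N k) = (d i N)\<^sup>2" for i N
  proof -
    have "(\<Sum>k\<in>I N. u i N k) = real (card (I N \<inter> D i N))"
      unfolding u_def using finI[of N] by (simp add: indicator_def of_bool_def sum.If_cases Int_def)
    also have "I N \<inter> D i N = D i N" by (auto simp: I_def)
    finally show ?thesis by (simp add: d_def)
  qed
  have uu_sum: "(\<Sum>k\<in>I N. u i N k * u j N k) = real (card (D i N \<inter> D j N))" for i j N
  proof -
    have "(\<Sum>k\<in>I N. u i N k * u j N k) = (\<Sum>k\<in>I N. indicat_real (D i N \<inter> D j N) k)"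
      unfolding u_def by (simp add: indicator_inter_arith)
    also have "\<dots> = real (card (I N \<inter> (D i N \<inter> D j N)))" using finI[of N] by (simp add: indicator_def of_bool_def sum.If_cases Int_def)
    also have "I N \<inter> (D i N \<inter> D j N) = D i N \<inter> D j N" by (auto simp: I_def)
    finally show ?thesis .
  qed
  define \<phi> where "\<phi> N k x = (\<Sum>i\<in>UNIV. a i / d i N * u i N k * \<psi> i x)" for N k x
  define V where "V N k w = \<phi> N k (X k w)" for N k w
  have \<phi>m[measurable]: "\<phi> N k \<in> borel_measurable S" for N k unfolding \<phi>_def by measurable
  have sum_V: "(\<Sum>i\<in>UNIV. a i * ((\<Sum>k\<in>D i N. \<psi> i (X k w)) / sqrt (card (D i N)))) = (\<Sum>k\<in>I N. V N k w)" for N w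
  proof -
    have "(\<Sum>k\<in>D i N. \<psi> i (X k w)) = (\<Sum>k\<in>I N. u i N k * \<psi> i (X k w))" for i
    proof (rule sum.mono_neutral_cong_left)
      show "D i N \<subseteq> I N" by (auto simp: I_def)
    qed (auto simp: finI u_def)
    then have "(\<Sum>i\<in>UNIV. a i * ((\<Sum>k\<in>D i N. \<psi> i (X k w)) / sqrt (card (D i N))))
        = (\<Sum>i\<in>UNIV. \<Sum>k\<in>I N. a i / d i N * u i N k * \<psi> i (X k w))"
      by (simp add: d_def sum_distrib_left sum_divide_distrib mult.assoc)
    also have "\<dots> = (\<Sum>k\<in>I N. V N k w)" unfolding V_def \<phi>_def by (rule sum.swap)
    finally show ?thesis .
  qed
  define \<mu> where "\<mu> i j = (\<integral>x. \<psi> i x * \<psi> j x \<partial>Q)" for i j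
  have int\<psi>\<psi>: "integrable Q (\<lambda>x. \<psi> i x * \<psi> j x)" for i j
    by (rule integrable_product_of_squares) (use int2 in auto)
  have \<phi>_square: "(\<phi> N k x)\<^sup>2 = (\<Sum>i\<in>UNIV. \<Sum>j\<in>UNIV. (a i / d i N) * (a j / d j N) * (u i N k * u j N k) * (\<psi> i x * \<psi> j x))" for N k x
    unfolding \<phi>_def power2_eq_square sum_product by (intro sum.cong refl) (simp only: mult_ac)
  have int\<phi>: "integrable Q (\<phi> N k)" for N k unfolding \<phi>_def using int by auto
  have int\<phi>2: "integrable Q (\<lambda>x. (\<phi> N k x)\<^sup>2)" for N k unfolding \<phi>_square using int\<psi>\<psi> by auto
  have var\<phi>: "(\<integral>x. (\<phi> N k x)\<^sup>2 \<partial>Q) = (\<Sum>i\<in>UNIV. \<Sum>j\<in>UNIV. (a i / d i N) * (a j / d j N) * (u i N k * u j N k) * \<mu> i j)" for N k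
    unfolding \<phi>_square \<mu>_def using int\<psi>\<psi> by (simp add: Bochner_Integration.integral_sum)
  define C where "C = real CARD('c)"
  have C0: "C \<ge> 0" by (simp add: C_def)
  have \<phi>2_le: "(\<phi> N k x)\<^sup>2 \<le> C * (\<Sum>i\<in>UNIV. (a i)\<^sup>2 / (d i N)\<^sup>2 * u i N k * (\<psi> i x)\<^sup>2)" for N k x
  proof -
    have "(a i / d i N * u i N k * \<psi> i x)\<^sup>2 = (a i)\<^sup>2 / (d i N)\<^sup>2 * u i N k * (\<psi> i x)\<^sup>2" for i
      using u01[of i N k] by (auto simp: power_mult_distrib power_divide)
    then show ?thesis
      unfolding \<phi>_def C_def using square_sum_le[of "\<lambda>i. a i / d i N * u i N k * \<psi> i x"] by simp
  qed
  define G where "G N x = (\<Sum>i\<in>UNIV. \<bar>a i\<bar> / d i N * \<bar>\<psi> i x\<bar>)" for N x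
  have G0: "G N x \<ge> 0" for N x unfolding G_def using d0 by (intro sum_nonneg) simp
  have [measurable]: "G N \<in> borel_measurable S" for N unfolding G_def by measurable
  have \<phi>_le_G: "\<bar>\<phi> N k x\<bar> \<le> G N x" for N k x
    unfolding \<phi>_def G_def
  proof (rule order_trans[OF sum_abs], rule sum_mono)
    fix i
    show "\<bar>a i / d i N * u i N k * \<psi> i x\<bar> \<le> \<bar>a i\<bar> / d i N * \<bar>\<psi> i x\<bar>"
      using u01[of i N k] d0[of i N] by (auto simp: abs_mult)
  qed
  have G_lim: "(\<lambda>N. G N x) \<longlonglongrightarrow> 0" for x
    unfolding G_def by (intro tendsto_null_sum tendsto_mult_left_zero d_inv)
  \<comment> \<open>Tends to 0 by dominated convergence, since \<open>G\<close> tends to 0 pointwise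
    and \<open>6 * (\<psi> i x)\<^sup>2\<close> dominates. The cap 6 comes from the Taylor
    remainder, and with it second moments suffice.\<close>
  define H where "H i N = (\<integral>x. (\<psi> i x)\<^sup>2 * min 6 (G N x) \<partial>Q)" for i N
  have intH: "integrable Q (\<lambda>x. (\<psi> i x)\<^sup>2 * min 6 (G N x))" for i N
  proof (rule Bochner_Integration.integrable_bound)
    show "integrable Q (\<lambda>x. 6 * (\<psi> i x)\<^sup>2)" using int2 by simp
    have "\<bar>(\<psi> i x)\<^sup>2 * min 6 (G N x)\<bar> \<le> 6 * (\<psi> i x)\<^sup>2" for x
      using G0[of N x] mult_left_mono[of "min 6 (G N x)" 6 "(\<psi> i x)\<^sup>2"] by (simp add: abs_mult)
    then show "AE x in Q. norm ((\<psi> i x)\<^sup>2 * min 6 (G N x)) \<le> norm (6 * (\<psi> i x)\<^sup>2)" by simp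
  qed measurable
  have H_lim: "H i \<longlonglongrightarrow> 0" for i
  proof -
    have "(\<lambda>N. \<integral>x. (\<psi> i x)\<^sup>2 * min 6 (G N x) \<partial>Q) \<longlonglongrightarrow> (\<integral>x. 0 \<partial>Q)"
    proof (rule integral_dominated_convergence[where w="\<lambda>x. 6 * (\<psi> i x)\<^sup>2"])
      have "(\<lambda>N. (\<psi> i x)\<^sup>2 * min 6 (G N x)) \<longlonglongrightarrow> (\<psi> i x)\<^sup>2 * min 6 0" for x
        by (intro tendsto_intros G_lim)
      then show "AE x in Q. (\<lambda>N. (\<psi> i x)\<^sup>2 * min 6 (G N x)) \<longlonglongrightarrow> 0" by simp
      have "\<bar>(\<psi> i x)\<^sup>2 * min 6 (G N x)\<bar> \<le> 6 * (\<psi> i x)\<^sup>2" for x N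
        using G0[of N x] mult_left_mono[of "min 6 (G N x)" 6 "(\<psi> i x)\<^sup>2"] by (simp add: abs_mult)
      then show "AE x in Q. norm ((\<psi> i x)\<^sup>2 * min 6 (G N x)) \<le> 6 * (\<psi> i x)\<^sup>2" for N by simp
    qed (use int2 in auto)
    then show ?thesis by (simp add: H_def[abs_def])
  qed
  have "(\<lambda>N. char (distr M borel (\<lambda>w. \<Sum>k\<in>I N. V N k w)) 1)
    \<longlonglongrightarrow> complex_of_real (exp (- (\<Sum>i\<in>UNIV. \<Sum>j\<in>UNIV. a i * a j * (\<rho> i j * \<mu> i j)) / 2))"
  proof (rule lindeberg_char_tendsto)
    fix N
    show "indep_vars (\<lambda>_. borel) (V N) (I N)"
      unfolding V_def[abs_def]
      by (rule indep_vars_compose2[OF indep_vars_subset[OF indep]]) auto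
    fix k
    show "integrable M (V N k)" unfolding V_def[abs_def] by (rule transfer_int[OF int\<phi>]) simp
    show "integrable M (\<lambda>w. (V N k w)\<^sup>2)"
      unfolding V_def by (rule transfer_int[OF int\<phi>2, of N k k]) simp
    have "expectation (V N k) = (\<integral>x. \<phi> N k x \<partial>Q)" unfolding V_def[abs_def] by (rule transfer) simp
    also have "\<dots> = 0" unfolding \<phi>_def using int mean by (simp add: Bochner_Integration.integral_sum)
    finally show "expectation (V N k) = 0" .
    have "expectation (\<lambda>w. (V N k w)\<^sup>2) = (\<integral>x. (\<phi> N k x)\<^sup>2 \<partial>Q)" unfolding V_def by (rule transfer) simp
    also have "\<dots> \<le> (\<integral>x. C * (\<Sum>i\<in>UNIV. (a i)\<^sup>2 / (d i N)\<^sup>2 * u i N k * (\<psi> i x)\<^sup>2) \<partial>Q)"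
      by (rule integral_mono) (use int\<phi>2 int2 \<phi>2_le in auto)
    also have "\<dots> = C * (\<Sum>i\<in>UNIV. (a i)\<^sup>2 / (d i N)\<^sup>2 * u i N k * (\<integral>x. (\<psi> i x)\<^sup>2 \<partial>Q))"
      using int2 by (simp add: Bochner_Integration.integral_sum)
    also have "\<dots> \<le> C * (\<Sum>i\<in>UNIV. (a i)\<^sup>2 / (d i N)\<^sup>2 * (\<integral>x. (\<psi> i x)\<^sup>2 \<partial>Q))"
    proof (intro mult_left_mono sum_mono C0)
      fix i
      show "(a i)\<^sup>2 / (d i N)\<^sup>2 * u i N k * (\<integral>x. (\<psi> i x)\<^sup>2 \<partial>Q) \<le> (a i)\<^sup>2 / (d i N)\<^sup>2 * (\<integral>x. (\<psi> i x)\<^sup>2 \<partial>Q)"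
        using u01[of i N k] by auto
    qed
    finally show "expectation (\<lambda>w. (V N k w)\<^sup>2) \<le> C * (\<Sum>i\<in>UNIV. (a i)\<^sup>2 / (d i N)\<^sup>2 * (\<integral>x. (\<psi> i x)\<^sup>2 \<partial>Q))" .
  next
    have "(\<lambda>N. C * (\<Sum>i\<in>UNIV. (a i / d i N)\<^sup>2 * (\<integral>x. (\<psi> i x)\<^sup>2 \<partial>Q))) \<longlonglongrightarrow> C * (\<Sum>i\<in>UNIV. 0\<^sup>2 * (\<integral>x. (\<psi> i x)\<^sup>2 \<partial>Q))"
      by (intro tendsto_intros d_inv)
    then show "(\<lambda>N. C * (\<Sum>i\<in>UNIV. (a i)\<^sup>2 / (d i N)\<^sup>2 * (\<integral>x. (\<psi> i x)\<^sup>2 \<partial>Q))) \<longlonglongrightarrow> 0"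
      by (simp add: power_divide)
  next
    have "(\<Sum>k\<in>I N. expectation (\<lambda>w. (V N k w)\<^sup>2))
        = (\<Sum>i\<in>UNIV. \<Sum>j\<in>UNIV. a i * a j * (real (card (D i N \<inter> D j N)) / (d i N * d j N) * \<mu> i j))" for N
    proof -
      have "(\<Sum>k\<in>I N. expectation (\<lambda>w. (V N k w)\<^sup>2))
        = (\<Sum>k\<in>I N. \<Sum>i\<in>UNIV. \<Sum>j\<in>UNIV. (a i / d i N) * (a j / d j N) * (u i N k * u j N k) * \<mu> i j)"
        unfolding V_def var\<phi>[symmetric] by (intro sum.cong refl transfer) simp
      also have "\<dots> = (\<Sum>i\<in>UNIV. \<Sum>k\<in>I N. \<Sum>j\<in>UNIV. (a i / d i N) * (a j / d j N) * (u i N k * u j N k) * \<mu> i j)"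
        by (rule sum.swap)
      also have "\<dots> = (\<Sum>i\<in>UNIV. \<Sum>j\<in>UNIV. \<Sum>k\<in>I N. (a i / d i N) * (a j / d j N) * (u i N k * u j N k) * \<mu> i j)"
        by (intro sum.cong refl sum.swap)
      also have "\<dots> = (\<Sum>i\<in>UNIV. \<Sum>j\<in>UNIV. (a i / d i N) * (a j / d j N) * (\<Sum>k\<in>I N. u i N k * u j N k) * \<mu> i j)"
        by (simp only: sum_distrib_left sum_distrib_right)
      also have "\<dots> = (\<Sum>i\<in>UNIV. \<Sum>j\<in>UNIV. a i * a j * (real (card (D i N \<inter> D j N)) / (d i N * d j N) * \<mu> i j))"
        unfolding uu_sum by (intro sum.cong refl) (simp add: mult_ac)
      finally show ?thesis .
    qed
    moreover have "(\<lambda>N. \<Sum>i\<in>UNIV. \<Sum>j\<in>UNIV. a i * a j * (real (card (D i N \<inter> D j N)) / (d i N * d j N) * \<mu> i j))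
        \<longlonglongrightarrow> (\<Sum>i\<in>UNIV. \<Sum>j\<in>UNIV. a i * a j * (\<rho> i j * \<mu> i j))"
      unfolding d_def by (intro tendsto_intros \<rho>)
    ultimately show "(\<lambda>N. \<Sum>k\<in>I N. expectation (\<lambda>w. (V N k w)\<^sup>2)) \<longlonglongrightarrow> (\<Sum>i\<in>UNIV. \<Sum>j\<in>UNIV. a i * a j * (\<rho> i j * \<mu> i j))"
      by simp
  next
    \<comment> \<open>One factor of the cube is replaced by the envelope \<open>G\<close>; the
      remaining square is split over the samples by Cauchy-Schwarz, at the cost of the factor
      \<open>C\<close>.\<close>
    have pointwise: "min (6 * (\<phi> N k x)\<^sup>2) (\<bar>\<phi> N k x\<bar> ^ 3)
        \<le> C * (\<Sum>i\<in>UNIV. (a i)\<^sup>2 / (d i N)\<^sup>2 * u i N k * ((\<psi> i x)\<^sup>2 * min 6 (G N x)))" for N k x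
    proof -
      have "\<bar>\<phi> N k x\<bar> ^ 3 = (\<phi> N k x)\<^sup>2 * \<bar>\<phi> N k x\<bar>" by (simp add: power3_eq_cube power2_eq_square)
      also have "\<dots> \<le> (\<phi> N k x)\<^sup>2 * G N x" by (intro mult_left_mono \<phi>_le_G) simp
      finally have "min (6 * (\<phi> N k x)\<^sup>2) (\<bar>\<phi> N k x\<bar> ^ 3) \<le> (\<phi> N k x)\<^sup>2 * min 6 (G N x)"
        by (auto simp: min_def mult.commute)
      also have "\<dots> \<le> C * (\<Sum>i\<in>UNIV. (a i)\<^sup>2 / (d i N)\<^sup>2 * u i N k * (\<psi> i x)\<^sup>2) * min 6 (G N x)"
        using G0[of N x] by (intro mult_right_mono \<phi>2_le) simp
      finally show ?thesis by (simp only: sum_distrib_right mult.assoc)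
    qed
    have le: "(\<Sum>k\<in>I N. expectation (\<lambda>w. min (6 * (V N k w)\<^sup>2) (\<bar>V N k w\<bar> ^ 3)))
        \<le> C * (\<Sum>i\<in>UNIV. (a i)\<^sup>2 * H i N)" for N
    proof -
      have H0: "H i N \<ge> 0" for i unfolding H_def using G0 by simp
      have "expectation (\<lambda>w. min (6 * (V N k w)\<^sup>2) (\<bar>V N k w\<bar> ^ 3))
          \<le> C * (\<Sum>i\<in>UNIV. (a i)\<^sup>2 / (d i N)\<^sup>2 * u i N k * H i N)" for k
      proof -
        have "expectation (\<lambda>w. min (6 * (V N k w)\<^sup>2) (\<bar>V N k w\<bar> ^ 3)) = (\<integral>x. min (6 * (\<phi> N k x)\<^sup>2) (\<bar>\<phi> N k x\<bar> ^ 3) \<partial>Q)"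
          unfolding V_def by (rule transfer) simp
        also have "\<dots> \<le> (\<integral>x. C * (\<Sum>i\<in>UNIV. (a i)\<^sup>2 / (d i N)\<^sup>2 * u i N k * ((\<psi> i x)\<^sup>2 * min 6 (G N x))) \<partial>Q)"
        proof (rule integral_mono[OF _ _ pointwise])
          show "integrable Q (\<lambda>x. min (6 * (\<phi> N k x)\<^sup>2) (\<bar>\<phi> N k x\<bar> ^ 3))"
          proof (rule Bochner_Integration.integrable_bound)
            show "integrable Q (\<lambda>x. 6 * (\<phi> N k x)\<^sup>2)" using int\<phi>2 by simp
          qed auto
        qed (use intH in auto)
        also have "\<dots> = C * (\<Sum>i\<in>UNIV. (a i)\<^sup>2 / (d i N)\<^sup>2 * u i N k * H i N)"
          unfolding H_def using intH by (simp add: Bochner_Integration.integral_sum)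
        finally show ?thesis .
      qed
      then have "(\<Sum>k\<in>I N. expectation (\<lambda>w. min (6 * (V N k w)\<^sup>2) (\<bar>V N k w\<bar> ^ 3)))
          \<le> (\<Sum>k\<in>I N. C * (\<Sum>i\<in>UNIV. (a i)\<^sup>2 / (d i N)\<^sup>2 * u i N k * H i N))"
        by (rule sum_mono)
      also have "\<dots> = C * (\<Sum>i\<in>UNIV. \<Sum>k\<in>I N. (a i)\<^sup>2 / (d i N)\<^sup>2 * u i N k * H i N)"
        unfolding sum_distrib_left[symmetric] by (subst sum.swap) (rule refl)
      also have "\<dots> = C * (\<Sum>i\<in>UNIV. (a i)\<^sup>2 / (d i N)\<^sup>2 * (d i N)\<^sup>2 * H i N)"
        by (simp only: u_sum flip: sum_distrib_left sum_distrib_right)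
      also have "\<dots> \<le> C * (\<Sum>i\<in>UNIV. (a i)\<^sup>2 * H i N)"
      proof (intro mult_left_mono sum_mono mult_right_mono C0 H0)
        fix i
        \<comment> \<open>Only an inequality, because for an empty sample the left side is 0 by
          division by zero.\<close>
        show "(a i)\<^sup>2 / (d i N)\<^sup>2 * (d i N)\<^sup>2 \<le> (a i)\<^sup>2" by (cases "d i N = 0") auto
      qed
      finally show ?thesis .
    qed
    have lim: "(\<lambda>N. C * (\<Sum>i\<in>UNIV. (a i)\<^sup>2 * H i N)) \<longlonglongrightarrow> 0"
      by (intro tendsto_mult_right_zero tendsto_null_sum H_lim)
    show "(\<lambda>N. \<Sum>k\<in>I N. expectation (\<lambda>w. min (6 * (V N k w)\<^sup>2) (\<bar>V N k w\<bar> ^ 3))) \<longlonglongrightarrow> 0"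
      by (rule tendsto_sandwich[OF _ _ tendsto_const lim])
        (use le in \<open>auto intro!: always_eventually sum_nonneg Bochner_Integration.integral_nonneg\<close>)
  qed
  then show ?thesis unfolding sum_V \<mu>_def .
qed

section \<open>Negligible remainders\<close>

text \<open>From \<open>min 1 \<bar>W\<bar>\<close> being at most \<open>e\<close> plus the
  indicator of \<open>\<bar>W\<bar> > e\<close>. The truncation makes the expectation meaningful for
  remainders without moments.\<close>

lemma (in prob_space) tendsto_in_prob_0_imp_expectation:
  assumes W[measurable]: "\<And>N. random_variable borel (W N)" and lim: "tendsto_in_prob_0 M W"
  shows "(\<lambda>N. expectation (\<lambda>w. min 1 \<bar>W N w\<bar>)) \<longlonglongrightarrow> 0"
proof (rule LIMSEQ_I)
  fix e' :: real assume "e' > 0"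
  define e where "e = e' / 2"
  have e: "e > 0" "e' = e + e" using \<open>e' > 0\<close> by (auto simp: e_def)
  let ?A = "\<lambda>N. {w \<in> space M. \<bar>W N w\<bar> > e}"
  have A[measurable]: "?A N \<in> events" for N by measurable
  have "(\<lambda>N. prob (?A N)) \<longlonglongrightarrow> 0"
    using lim e(1) unfolding tendsto_in_prob_0_def by blast
  then have "eventually (\<lambda>N. prob (?A N) < e) sequentially"
    using e(1) by (rule order_tendstoD(2))
  then have "eventually (\<lambda>N. norm (expectation (\<lambda>w. min 1 \<bar>W N w\<bar>) - 0) < e') sequentially"
  proof eventually_elim
    case (elim N)
    have int: "integrable M (indicat_real (?A N))"
      by (rule integrable_real_indicator[OF A]) (simp add: emeasure_eq_measure)
    have "expectation (\<lambda>w. min 1 \<bar>W N w\<bar>) \<le> expectation (\<lambda>w. e + indicat_real (?A N) w)"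
    proof (rule integral_mono)
      show "integrable M (\<lambda>w. min 1 \<bar>W N w\<bar>)"
        by (rule integrable_const_bound[where B=1]) auto
      show "integrable M (\<lambda>w. e + indicat_real (?A N) w)"
        using int by (intro Bochner_Integration.integrable_add) auto
      show "min 1 \<bar>W N w\<bar> \<le> e + indicat_real (?A N) w" if "w \<in> space M" for w
        using that e(1) by (auto simp: indicator_def)
    qed
    also have "expectation (\<lambda>w. e + indicat_real (?A N) w) = e + prob (?A N)"
      using int A[of N] by (subst Bochner_Integration.integral_add) (auto simp: prob_space)
    finally have "expectation (\<lambda>w. min 1 \<bar>W N w\<bar>) < e'" using elim e(2) by linarith
    moreover have "expectation (\<lambda>w. min 1 \<bar>W N w\<bar>) \<ge> 0" by simp
    ultimately show ?case by simp
  qed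
  then show "\<exists>no. \<forall>N\<ge>no. norm (expectation (\<lambda>w. min 1 \<bar>W N w\<bar>) - 0) < e'"
    by (auto simp: eventually_sequentially)
qed

lemma norm_iexp_diff_le: "norm (iexp x - iexp y) \<le> \<bar>x - y\<bar>"
proof -
  have "iexp x - iexp y = iexp y * (iexp (x - y) - 1)"
    by (simp add: algebra_simps flip: exp_add)
  then have "norm (iexp x - iexp y) = norm (iexp (x - y) - 1)" by (simp add: norm_mult)
  also have "\<dots> \<le> \<bar>x - y\<bar>" using iexp_approx1[of "x - y" 0] by simp
  finally show ?thesis .
qed

text \<open>Slutsky's lemma at the level of characteristic functions, applied to each linear
  combination of the scaled errors to discard the \<open>o_p\<close> terms.\<close>

lemma (in prob_space) char_tendsto_perturbation:
  fixes W :: "'c::finite \<Rightarrow> nat \<Rightarrow> 'a \<Rightarrow> real"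
  assumes Y[measurable]: "\<And>N. random_variable borel (Y N)" and Z[measurable]: "\<And>N. random_variable borel (Z N)"
    and W[measurable]: "\<And>i N. random_variable borel (W i N)"
    and W0: "\<And>i. tendsto_in_prob_0 M (W i)"
    and YZ: "\<And>N w. w \<in> space M \<Longrightarrow> Y N w = Z N w + (\<Sum>i\<in>UNIV. a i * W i N w)"
    and lim: "(\<lambda>N. char (distr M borel (Z N)) 1) \<longlonglongrightarrow> c"
  shows "(\<lambda>N. char (distr M borel (Y N)) 1) \<longlonglongrightarrow> c"
proof -
  \<comment> \<open>The weight covers two cases: if all remainders are at most 1, the Lipschitz
    bound uses \<open>\<bar>a i\<bar>\<close>; otherwise a single index with a remainder above 1
    already provides the trivial bound 2.\<close>
  let ?b = "\<lambda>N w. \<Sum>i\<in>UNIV. (2 + \<bar>a i\<bar>) * min 1 \<bar>W i N w\<bar>"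
  have pointwise: "norm (iexp (Y N w) - iexp (Z N w)) \<le> ?b N w" if w: "w \<in> space M" for N w
  proof (cases "\<forall>i. \<bar>W i N w\<bar> \<le> 1")
    case True
    have "norm (iexp (Y N w) - iexp (Z N w)) \<le> \<bar>Y N w - Z N w\<bar>" by (rule norm_iexp_diff_le)
    also have "\<dots> = \<bar>\<Sum>i\<in>UNIV. a i * W i N w\<bar>" by (simp add: YZ[OF w])
    also have "\<dots> \<le> (\<Sum>i\<in>UNIV. \<bar>a i * W i N w\<bar>)" by (rule sum_abs)
    also have "\<dots> \<le> ?b N w"
      using True by (intro sum_mono) (simp add: abs_mult min_absorb2 mult_right_mono)
    finally show ?thesis .
  next
    case False
    then obtain i where i: "\<bar>W i N w\<bar> > 1" by (auto simp: not_le)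
    have "norm (iexp (Y N w) - iexp (Z N w)) \<le> norm (iexp (Y N w)) + norm (iexp (Z N w))"
      by (rule norm_triangle_ineq4)
    also have "\<dots> \<le> (2 + \<bar>a i\<bar>) * min 1 \<bar>W i N w\<bar>" using i by simp
    also have "\<dots> \<le> ?b N w"
      by (rule member_le_sum[where f="\<lambda>i. (2 + \<bar>a i\<bar>) * min 1 \<bar>W i N w\<bar>"]) auto
    finally show ?thesis .
  qed
  have minint: "integrable M (\<lambda>w. min 1 \<bar>W i N w\<bar>)" for i N
    by (rule integrable_const_bound[where B=1]) auto
  have expint: "integrable M (\<lambda>w. iexp (U w))" if [measurable]: "random_variable borel U" for U
    by (rule integrable_const_bound[where B=1]) auto
  have char: "char (distr M borel U) 1 = (CLINT w|M. iexp (U w))" if [measurable]: "random_variable borel U" for U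
    unfolding char_def by (subst integral_distr) auto
  have bound: "norm (char (distr M borel (Y N)) 1 - char (distr M borel (Z N)) 1)
      \<le> (\<Sum>i\<in>UNIV. (2 + \<bar>a i\<bar>) * expectation (\<lambda>w. min 1 \<bar>W i N w\<bar>))" for N
  proof -
    have "norm (char (distr M borel (Y N)) 1 - char (distr M borel (Z N)) 1)
        = norm (CLINT w|M. iexp (Y N w) - iexp (Z N w))"
      unfolding char[OF Y] char[OF Z]
      by (subst Bochner_Integration.integral_diff[OF expint[OF Y] expint[OF Z]]) (rule refl)
    also have "\<dots> \<le> expectation (?b N)"
    proof (rule order_trans[OF integral_norm_bound], rule integral_mono)
      show "integrable M (\<lambda>w. norm (iexp (Y N w) - iexp (Z N w)))"
        by (intro integrable_norm Bochner_Integration.integrable_diff expint Y Z)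
      show "integrable M (?b N)" using minint by auto
    qed (rule pointwise)
    also have "\<dots> = (\<Sum>i\<in>UNIV. (2 + \<bar>a i\<bar>) * expectation (\<lambda>w. min 1 \<bar>W i N w\<bar>))"
      using minint by (simp add: Bochner_Integration.integral_sum)
    finally show ?thesis .
  qed
  have null: "(\<lambda>N. \<Sum>i\<in>UNIV. (2 + \<bar>a i\<bar>) * expectation (\<lambda>w. min 1 \<bar>W i N w\<bar>)) \<longlonglongrightarrow> 0"
    by (intro tendsto_null_sum tendsto_mult_right_zero tendsto_in_prob_0_imp_expectation W W0)
  have "(\<lambda>N. char (distr M borel (Y N)) 1 - char (distr M borel (Z N)) 1) \<longlonglongrightarrow> 0"
    by (rule Lim_null_comparison[OF always_eventually null]) (rule allI, rule bound)
  with lim show ?thesis by (rule Lim_transform)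
qed

section \<open>Moments of the limit law and auxiliary facts\<close>

text \<open>The hypothesis gives the variance of every linear form, and polarisation with the forms
  \<open>x $ i\<close>, \<open>x $ j\<close> and their sum recovers the mixed moment.\<close>

lemma gaussian_covariance:
  fixes \<nu> :: "(real ^ 'c::finite) measure"
  assumes "prob_space \<nu>" and sets: "sets \<nu> = sets borel"
    and distr: "\<And>a. distr \<nu> borel (\<lambda>x. a \<bullet> x) = normal_law 0 (sqrt (\<Sum>i\<in>UNIV. \<Sum>j\<in>UNIV. a $ i * a $ j * A i j))"
    and sym: "\<And>i j. A i j = A j i" and psd: "\<And>a. (\<Sum>i\<in>UNIV. \<Sum>j\<in>UNIV. a i * a j * A i j) \<ge> 0"
  shows "covariance \<nu> (\<lambda>x. x $ i) (\<lambda>x. x $ j) = A i j"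
proof -
  have [measurable_cong]: "sets \<nu> = sets borel" by fact
  define q where "q a = (\<Sum>i\<in>UNIV. \<Sum>j\<in>UNIV. a $ i * a $ j * A i j)" for a :: "real ^ 'c"
  have q0: "q a \<ge> 0" for a unfolding q_def using psd[of "\<lambda>i. a $ i"] by simp
  have m: "(\<lambda>x. a \<bullet> x) \<in> borel_measurable \<nu>" for a by measurable
  note d = distr[folded q_def]
  have s: "sqrt (q a) \<ge> 0" for a using q0 by simp
  have mi: "(\<lambda>x. x) \<in> borel_measurable (borel::real measure)"
    "(\<lambda>x. x\<^sup>2) \<in> borel_measurable (borel::real measure)" by simp_all
  have mean: "(\<integral>x. a \<bullet> x \<partial>\<nu>) = 0" for a
    using normal_law_mean[OF s[of a]] unfolding d[symmetric] integral_distr[OF m mi(1)] .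
  have square: "(\<integral>x. (a \<bullet> x)\<^sup>2 \<partial>\<nu>) = q a" for a
    using normal_law_second_moment[OF s[of a]] q0[of a]
    unfolding d[symmetric] integral_distr[OF m mi(2)] by simp
  have int: "integrable \<nu> (\<lambda>x. (a \<bullet> x)\<^sup>2)" for a
    using integrable_normal_law_square[OF s[of a]]
    unfolding d[symmetric] integrable_distr_eq[OF m mi(2)] .
  let ?e = "\<lambda>i. axis i (1::real) :: real ^ 'c"
  have coord: "?e i \<bullet> x = x $ i" for i x by (simp add: inner_axis')
  have q_axis: "q (?e i + ?e j) = A i i + A j j + 2 * A i j" and q_axis1: "q (?e i) = A i i" for i j
  proof -
    have e: "(\<Sum>l\<in>UNIV. ?e k $ l * f l) = f k" for k and f :: "'c \<Rightarrow> real"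
      using coord[of k "\<chi> l. f l"] by (simp add: inner_vec_def)
    have B: "(\<Sum>k\<in>UNIV. \<Sum>l\<in>UNIV. ?e i $ k * ?e j $ l * A k l) = A i j" for i j
      by (simp only: mult.assoc sum_distrib_left[symmetric] e)
    show "q (?e i) = A i i" unfolding q_def by (rule B)
    have "q (?e i + ?e j) = (A i i + A i j) + (A j i + A j j)"
      unfolding q_def
      by (simp only: vector_add_component distrib_right distrib_left sum.distrib B add_ac)
    then show "q (?e i + ?e j) = A i i + A j j + 2 * A i j" using sym[of j i] by simp
  qed
  have "(\<integral>x. x $ i * x $ j \<partial>\<nu>) = (\<integral>x. (((?e i + ?e j) \<bullet> x)\<^sup>2 - (?e i \<bullet> x)\<^sup>2 - (?e j \<bullet> x)\<^sup>2) / 2 \<partial>\<nu>)"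
    by (rule Bochner_Integration.integral_cong) (simp_all add: coord inner_add_left power2_sum)
  also have "\<dots> = (q (?e i + ?e j) - q (?e i) - q (?e j)) / 2"
    using int by (simp add: square)
  also have "\<dots> = A i j" by (simp add: q_axis q_axis1)
  finally have "(\<integral>x. x $ i * x $ j \<partial>\<nu>) = A i j" .
  moreover have "(\<integral>x. x $ k \<partial>\<nu>) = 0" for k using mean[of "?e k"] by (simp add: coord)
  ultimately show ?thesis by (simp add: covariance_def)
qed

lemma (in prob_space) statistic_on_measurable:
  assumes "statistic_on M S X D T" and X: "\<And>k. X k \<in> measurable M S"
  shows "T \<in> borel_measurable M"
proof -
  from assms obtain g where g: "g \<in> borel_measurable (Pi\<^sub>M D (\<lambda>_. S))"
    and T: "\<And>w. w \<in> space M \<Longrightarrow> T w = g (\<lambda>k\<in>D. X k w)"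
    unfolding statistic_on_def by blast
  have "(\<lambda>w. \<lambda>k\<in>D. X k w) \<in> measurable M (Pi\<^sub>M D (\<lambda>_. S))"
    by (rule measurable_restrict) (rule X)
  then have "(\<lambda>w. g (\<lambda>k\<in>D. X k w)) \<in> borel_measurable M"
    by (rule measurable_compose) (rule g)
  then show ?thesis by (subst measurable_cong[OF T])
qed

text \<open>With \<open>s\<close> and \<open>t\<close> the norms of \<open>f\<close> and
  \<open>g\<close>, the integral of the square of \<open>t * f - s * g\<close> is nonnegative;
  expanding it and dividing by \<open>s * t > 0\<close> gives the bound.\<close>

lemma integral_cauchy_schwarz:
  fixes f g :: "'a \<Rightarrow> real"
  assumes m: "f \<in> borel_measurable M" "g \<in> borel_measurable M"
    and i: "integrable M (\<lambda>x. (f x)\<^sup>2)" "integrable M (\<lambda>x. (g x)\<^sup>2)"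
    and pos: "(\<integral>x. (f x)\<^sup>2 \<partial>M) > 0" "(\<integral>x. (g x)\<^sup>2 \<partial>M) > 0"
  shows "(\<integral>x. f x * g x \<partial>M) \<le> sqrt ((\<integral>x. (f x)\<^sup>2 \<partial>M) * (\<integral>x. (g x)\<^sup>2 \<partial>M))"
proof -
  define s t where "s = sqrt (\<integral>x. (f x)\<^sup>2 \<partial>M)" and "t = sqrt (\<integral>x. (g x)\<^sup>2 \<partial>M)"
  have st: "s > 0" "t > 0" "(\<integral>x. (f x)\<^sup>2 \<partial>M) = s\<^sup>2" "(\<integral>x. (g x)\<^sup>2 \<partial>M) = t\<^sup>2"
    using pos by (simp_all add: s_def t_def)
  have fg: "integrable M (\<lambda>x. f x * g x)" by (rule integrable_product_of_squares[OF m i])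
  have "0 \<le> (\<integral>x. (t * f x - s * g x)\<^sup>2 \<partial>M)" by simp
  also have "\<dots> = (\<integral>x. t\<^sup>2 * (f x)\<^sup>2 + s\<^sup>2 * (g x)\<^sup>2 - 2 * s * t * (f x * g x) \<partial>M)"
    by (intro Bochner_Integration.integral_cong refl) (simp add: power2_eq_square algebra_simps)
  also have "\<dots> = t\<^sup>2 * s\<^sup>2 + s\<^sup>2 * t\<^sup>2 - 2 * s * t * (\<integral>x. f x * g x \<partial>M)"
    using i fg by (simp add: st)
  finally have "(s * t) * (\<integral>x. f x * g x \<partial>M) \<le> (s * t) * (s * t)"
    by (simp add: power2_eq_square algebra_simps)
  then have "(\<integral>x. f x * g x \<partial>M) \<le> s * t" using st(1,2) by (simp add: mult_le_cancel_left_pos)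
  then show ?thesis by (simp add: s_def t_def real_sqrt_mult)
qed

text \<open>Turns the \<open>o_p\<close> rate into the scaling of the errors. At
  \<open>n = 0\<close> both sides are 0, because \<open>0 powr a\<close> and \<open>x / 0\<close>
  are 0.\<close>

lemma real_div_powr_minus_half:
  "x / real n powr (- 1 / 2) = x * sqrt (real n)"
  by (cases "n = 0") (simp_all add: powr_minus powr_half_sqrt divide_simps flip: minus_divide_left)

section \<open>The limit law of the scaled errors and its correlations\<close>

theorem corollary1:
  fixes M :: "'a measure" and S :: "'b measure"
    and X :: "nat \<Rightarrow> 'a \<Rightarrow> 'b"
    and D :: "'c::finite \<Rightarrow> nat \<Rightarrow> nat set"
    and n :: "'c \<Rightarrow> nat \<Rightarrow> nat"
    and r :: "'c \<Rightarrow> nat \<Rightarrow> real"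
    and \<omega> :: "'c \<Rightarrow> 'c \<Rightarrow> nat \<Rightarrow> real"
    and T :: "'c \<Rightarrow> nat \<Rightarrow> 'a \<Rightarrow> real"
    and \<theta> :: "'c \<Rightarrow> real"
    and \<psi> :: "'c \<Rightarrow> 'b \<Rightarrow> real"
    and \<rho> :: "'c \<Rightarrow> 'c \<Rightarrow> real"
  assumes "prob_space M"
    and "iid M S X"
    and "\<And>i N. D i N \<subseteq> {1..N}"
    and "\<And>i N. n i N = card (D i N)"
    and "\<And>i N. r i N = real (n i N) / real N"
    and "\<And>i j N. \<omega> i j N = real (card (D i N \<inter> D j N)) / real N"
    and "\<And>i N. statistic_on M S X (D i N) (T i N)"
    and "\<And>i. asymptotically_linear M S X (D i) (T i) (\<theta> i) (\<psi> i)"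
    and "\<And>i. (\<integral>w. (\<psi> i (X 0 w))\<^sup>2 \<partial>M) > 0"
    and "\<And>i. filterlim (\<lambda>N. real N * r i N) at_top sequentially"
    and "\<And>i j. (\<lambda>N. \<omega> i j N / sqrt (r i N * r j N)) \<longlonglongrightarrow> \<rho> i j"
  shows "(\<exists>!\<nu>. limiting_normal_law M (scaled_errors n \<theta> T) \<nu>) \<and>
    (\<forall>i j.
      asymptotic_correlation M (scaled_errors n \<theta> T) i j
        \<le> \<rho> i j * ((\<integral>w. \<psi> i (X 0 w) * \<psi> j (X 0 w) \<partial>M)
            / sqrt ((\<integral>w. (\<psi> i (X 0 w))\<^sup>2 \<partial>M) * (\<integral>w. (\<psi> j (X 0 w))\<^sup>2 \<partial>M))) \<and>
      \<rho> i j * ((\<integral>w. \<psi> i (X 0 w) * \<psi> j (X 0 w) \<partial>M)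
            / sqrt ((\<integral>w. (\<psi> i (X 0 w))\<^sup>2 \<partial>M) * (\<integral>w. (\<psi> j (X 0 w))\<^sup>2 \<partial>M)))
        \<le> \<rho> i j)"
proof -
  interpret prob_space M by fact
  have indep: "indep_vars (\<lambda>_. S) X UNIV" and ident: "\<And>k. distr M S (X k) = distr M S (X 0)"
    using assms(2) unfolding iid_def by auto
  define Q where "Q = distr M S (X 0)"
  have distrQ: "distr M S (X k) = Q" for k unfolding Q_def by (rule ident)
  have X[measurable]: "X k \<in> measurable M S" for k using indep unfolding indep_vars_def2 by auto
  note al = assms(8)[unfolded asymptotically_linear_def]
  have \<psi>[measurable]: "\<psi> i \<in> borel_measurable S" for i using al by blast
  have \<psi>Q: "\<psi> i \<in> borel_measurable Q" for i by (simp add: Q_def)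
  have transfer: "(\<integral>w. g (X 0 w) \<partial>M) = (\<integral>x. g x \<partial>Q)" if "g \<in> borel_measurable S" for g :: "'b \<Rightarrow> real"
    unfolding Q_def by (rule integral_distr[symmetric]) (use that X in auto)
  have transfer_int: "integrable M (\<lambda>w. g (X 0 w)) \<longleftrightarrow> integrable Q g" if "g \<in> borel_measurable S" for g :: "'b \<Rightarrow> real"
    unfolding Q_def by (rule integrable_distr_eq[symmetric]) (use that X in auto)
  define \<mu> where "\<mu> i j = (\<integral>x. \<psi> i x * \<psi> j x \<partial>Q)" for i j
  have \<mu>M: "(\<integral>w. \<psi> i (X 0 w) * \<psi> j (X 0 w) \<partial>M) = \<mu> i j" for i j
    unfolding \<mu>_def by (rule transfer) simp
  have \<mu>M2: "(\<integral>w. (\<psi> i (X 0 w))\<^sup>2 \<partial>M) = \<mu> i i" for i using \<mu>M[of i i] by (simp add: power2_eq_square)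
  have \<mu>_pos: "\<mu> i i > 0" for i using assms(9)[of i] unfolding \<mu>M2 .
  have \<mu>_square: "(\<integral>x. (\<psi> i x)\<^sup>2 \<partial>Q) = \<mu> i i" for i by (simp add: \<mu>_def power2_eq_square)
  have int: "integrable Q (\<psi> i)" for i using al transfer_int[OF \<psi>] by blast
  have mean: "(\<integral>x. \<psi> i x \<partial>Q) = 0" for i using al transfer[OF \<psi>] by metis
  have int2: "integrable Q (\<lambda>x. (\<psi> i x)\<^sup>2)" for i
  proof -
    have "expectation (\<lambda>w. \<psi> i (X 0 w)) = 0"
      and "integrable M (\<lambda>w. (\<psi> i (X 0 w) - expectation (\<lambda>v. \<psi> i (X 0 v)))\<^sup>2)"
      using al[of i] by blast+
    then have "integrable M (\<lambda>w. (\<psi> i (X 0 w))\<^sup>2)" by simp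
    then show ?thesis using transfer_int[of "\<lambda>x. (\<psi> i x)\<^sup>2"] by simp
  qed
  have fin: "finite (D i N)" for i N using assms(3) finite_subset by blast
  have n_lim: "filterlim (\<lambda>N. real (card (D i N))) at_top sequentially" for i
  proof -
    \<comment> \<open>At \<open>N = 0\<close> the sample is a subset of \<open>{1..0}\<close>, hence
      empty, and both sides are 0.\<close>
    have "real N * r i N = real (card (D i N))" for N
      using assms(3)[of i N] by (cases "N = 0") (simp_all add: assms(4,5))
    then show ?thesis using assms(10)[of i] by simp
  qed
  have \<rho>_lim: "(\<lambda>N. real (card (D i N \<inter> D j N)) / (sqrt (card (D i N)) * sqrt (card (D j N)))) \<longlonglongrightarrow> \<rho> i j" for i j
  proof -
    have "\<omega> i j N / sqrt (r i N * r j N) = real (card (D i N \<inter> D j N)) / (sqrt (card (D i N)) * sqrt (card (D j N)))" for N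
    proof (cases "N = 0")
      case True
      then show ?thesis using assms(3)[of i N] by (simp add: assms(4-6))
    next
      case False
      have "r i N * r j N = real (card (D i N)) * real (card (D j N)) / (real N)\<^sup>2"
        by (simp add: assms(4,5) power2_eq_square)
      then have "sqrt (r i N * r j N) = sqrt (card (D i N)) * sqrt (card (D j N)) / real N"
        by (simp add: real_sqrt_divide real_sqrt_mult)
      then show ?thesis using False by (simp add: assms(6))
    qed
    then show ?thesis using assms(11)[of i j] by simp
  qed
  have \<rho>_nonneg: "\<rho> i j \<ge> 0" for i j by (rule LIMSEQ_le_const[OF \<rho>_lim]) auto
  have \<rho>_diag: "\<rho> i i = 1" for i
  proof (rule LIMSEQ_unique[OF \<rho>_lim])
    \<comment> \<open>The diagonal ratio is 1 only for nonempty samples; for empty ones it is 0 by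
      division by zero.\<close>
    have "eventually (\<lambda>N. real (card (D i N)) > 0) sequentially"
      using n_lim[of i] unfolding filterlim_at_top_dense by blast
    then show "(\<lambda>N. real (card (D i N \<inter> D i N)) / (sqrt (card (D i N)) * sqrt (card (D i N)))) \<longlonglongrightarrow> 1"
      by (intro tendsto_eventually) (auto elim!: eventually_mono)
  qed
  have \<rho>_sym: "\<rho> i j = \<rho> j i" for i j
    using \<rho>_lim[of i j] \<rho>_lim[of j i] by (simp add: LIMSEQ_unique Int_commute mult.commute)
  define A where "A i j = \<rho> i j * \<mu> i j" for i j
  have A_sym: "A i j = A j i" for i j unfolding A_def \<mu>_def by (simp add: \<rho>_sym[of i j] mult.commute)
  define q where "q a = (\<Sum>i\<in>UNIV. \<Sum>j\<in>UNIV. a i * a j * A i j)" for a :: "'c \<Rightarrow> real"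
  define Z where "Z a N w = (\<Sum>i\<in>UNIV. a i * ((\<Sum>k\<in>D i N. \<psi> i (X k w)) / sqrt (card (D i N))))" for a N w
  have Zm[measurable]: "random_variable borel (Z a N)" for a N unfolding Z_def by measurable
  have Z_lim: "(\<lambda>N. char (distr M borel (Z a N)) 1) \<longlonglongrightarrow> complex_of_real (exp (- q a / 2))" for a
    unfolding Z_def q_def A_def \<mu>_def
    by (rule clt_overlapping_samples[OF indep distrQ \<psi> int int2 mean fin n_lim \<rho>_lim])
  \<comment> \<open>Positive semidefiniteness of \<open>A\<close>: the limit
    \<open>exp (- q a / 2)\<close> of characteristic functions inherits the bound 1 on the
    modulus.\<close>
  have q0: "q a \<ge> 0" for a
  proof -
    have "norm (complex_of_real (exp (- q a / 2))) \<le> 1"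
    proof (rule LIMSEQ_le_const2[OF tendsto_norm[OF Z_lim]])
      show "\<exists>N. \<forall>n\<ge>N. norm (char (distr M borel (Z a n)) 1) \<le> 1"
        using real_distribution.cmod_char_le_1[OF real_distribution_distr[OF Zm]] by blast
    qed
    then show ?thesis by simp
  qed
  obtain \<nu> :: "(real ^ 'c) measure" where \<nu>: "prob_space \<nu>" "sets \<nu> = sets borel"
    "\<And>a. distr \<nu> borel (\<lambda>x. a \<bullet> x) = normal_law 0 (sqrt (\<Sum>i\<in>UNIV. \<Sum>j\<in>UNIV. a $ i * a $ j * A i j))"
    using gaussian_exists[of A] A_sym q0[unfolded q_def] by blast
  have Tm[measurable]: "random_variable borel (T i N)" for i N
    by (rule statistic_on_measurable[OF assms(7) X])
  let ?Y = "scaled_errors n \<theta> T"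
  have Ym[measurable]: "?Y N \<in> borel_measurable M" for N
    unfolding scaled_errors_def
    by (subst borel_measurable_euclidean_space) (auto simp: Basis_vec_def inner_axis)
  define W where "W i N w = ((T i N w - \<theta> i) - 1 / real (card (D i N)) * (\<Sum>k\<in>D i N. \<psi> i (X k w)))
      / real (card (D i N)) powr (- 1 / 2)" for i N w
  have Wm[measurable]: "random_variable borel (W i N)" for i N unfolding W_def by measurable
  have W0: "tendsto_in_prob_0 M (W i)" for i
    using al[of i] unfolding W_def small_o_p_def by blast
  \<comment> \<open>An exact identity for every \<open>N\<close>: for an empty sample the scaled
    error, the sum and the remainder in that coordinate are all 0.\<close>
  have Y_eq: "a \<bullet> ?Y N w = Z (\<lambda>i. a $ i) N w + (\<Sum>i\<in>UNIV. a $ i * W i N w)" for a N w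
  proof -
    have "sqrt (n i N) * (T i N w - \<theta> i) = (\<Sum>k\<in>D i N. \<psi> i (X k w)) / sqrt (card (D i N)) + W i N w" for i
      unfolding W_def real_div_powr_minus_half assms(4)
      by (cases "card (D i N) = 0") (use fin in \<open>auto simp: field_simps\<close>)
    then show ?thesis
      unfolding Z_def scaled_errors_def inner_vec_def
      by (simp add: distrib_left sum.distrib)
  qed
  have "weakly_converges (\<lambda>N. distr M borel (?Y N)) \<nu>"
  proof (rule weakly_converges_of_characteristic)
    fix a :: "real ^ 'c"
    have "(\<lambda>N. char (distr M borel (\<lambda>w. a \<bullet> ?Y N w)) 1) \<longlonglongrightarrow> complex_of_real (exp (- q (\<lambda>i. a $ i) / 2))"
      by (rule char_tendsto_perturbation[OF _ _ Wm W0 Y_eq Z_lim]) measurable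
    moreover have "(CLINT x|\<nu>. iexp (a \<bullet> x)) = complex_of_real (exp (- q (\<lambda>i. a $ i) / 2))"
    proof -
      have [measurable_cong]: "sets \<nu> = sets borel" by (rule \<nu>(2))
      have "(CLINT x|\<nu>. iexp (a \<bullet> x)) = char (distr \<nu> borel (\<lambda>x. a \<bullet> x)) 1"
        unfolding char_def by (subst integral_distr) auto
      also have "\<dots> = complex_of_real (exp (- q (\<lambda>i. a $ i) / 2))"
        unfolding \<nu>(3) q_def[symmetric] by (subst char_normal_law) (use q0 in auto)
      finally show ?thesis .
    qed
    moreover have "(CLINT x|distr M borel (?Y N). iexp (a \<bullet> x)) = char (distr M borel (\<lambda>w. a \<bullet> ?Y N w)) 1" for N
      unfolding char_def by (subst (1 2) integral_distr) auto
    ultimately show "(\<lambda>N. CLINT x|distr M borel (?Y N). iexp (a \<bullet> x)) \<longlonglongrightarrow> (CLINT x|\<nu>. iexp (a \<bullet> x))"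
      by simp
  qed (simp_all add: prob_space_distr \<nu>(1,2))
  moreover have "multivariate_normal \<nu>"
    unfolding multivariate_normal_def
  proof (intro conjI allI \<nu>(1,2))
    fix a :: "real ^ 'c"
    show "\<exists>m s. s \<ge> 0 \<and> distr \<nu> borel (\<lambda>x. a \<bullet> x) = normal_law m s"
      using \<nu>(3)[of a] q0[of "\<lambda>i. a $ i"] unfolding q_def by (meson real_sqrt_ge_zero)
  qed
  ultimately have lim: "limiting_normal_law M ?Y \<nu>" unfolding limiting_normal_law_def by blast
  have unique: "\<nu>' = \<nu>" if "limiting_normal_law M ?Y \<nu>'" for \<nu>'
    using lim that unfolding limiting_normal_law_def multivariate_normal_def
    by (blast intro: weak_limit_unique)
  have the: "(THE \<nu>. limiting_normal_law M ?Y \<nu>) = \<nu>"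
    using lim unique by (rule the_equality)
  have cov: "covariance \<nu> (\<lambda>x. x $ i) (\<lambda>x. x $ j) = A i j" for i j
    by (rule gaussian_covariance[OF \<nu> A_sym q0[unfolded q_def]])
  have corr: "asymptotic_correlation M ?Y i j = \<rho> i j * (\<mu> i j / sqrt (\<mu> i i * \<mu> j j))" for i j
    unfolding asymptotic_correlation_def the correlation_def cov by (simp add: A_def \<rho>_diag)
  have "\<mu> i j / sqrt (\<mu> i i * \<mu> j j) \<le> 1" for i j
    using integral_cauchy_schwarz[OF \<psi>Q[of i] \<psi>Q[of j] int2 int2] \<mu>_pos[of i] \<mu>_pos[of j]
    unfolding \<mu>_square by (simp add: \<mu>_def[of i j, symmetric])
  then have "\<rho> i j * (\<mu> i j / sqrt (\<mu> i i * \<mu> j j)) \<le> \<rho> i j" for i j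
    using \<rho>_nonneg by (intro mult_left_le)
  moreover have "\<exists>!\<nu>. limiting_normal_law M ?Y \<nu>"
    using lim unique by (rule ex1I)
  ultimately show ?thesis unfolding \<mu>M \<mu>M2 corr by simp
qed

end
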